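(* Let $g,\tilde g$ be positive integers, let $\mathcal U\subseteq M(\mathbb C)^g$ and $\mathcal V\subseteq M(\mathbb C)^{\tilde g}$ be non-commutative domains, both containing $0$, and let $f:\mathcal U\to\mathcal V$ be a free map. (1) If $f$ is proper, then $f$ is one-to-one (i.e. each $f[n]$ is injective) and $f^{-1}:f(\mathcal U)\to\mathcal U$, $f^{-1}=(f[n]^{-1})_n$ with $f[n]^{-1}:f[n](\mathcal U(n))\to\mathcal U(n)$, is a free map. (2) If, for each $n$ and each $Z\in M_n(\mathbb C)^{\tilde g}$, the set $f[n]^{-1}(\{Z\})$ has compact closure in $\mathcal U(n)$, then $f$ is one-to-one and $f^{-1}:f(\mathcal U)\to\mathcal U$ is a free map. (3) If $g=\tilde g$ and $f:\mathcal U\to\mathcal V$ is proper and continuous, then $f$ is bianalytic: for every $n$, $f[n]$ is a bijection of $\mathcal U(n)$ onto $\mathcal V(n)$, and both $f$ and $f^{-1}:\mathcal V\to\mathcal U$ are proper analytic free maps.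
   Context: For $n\in\mathbb N$, $M_n(\mathbb C)^g$ denotes the set of $g$-tuples $X=(X_1,\dots,X_g)$ of $n\times n$ complex matrices. For $X\in M_n(\mathbb C)^g$, $Y\in M_m(\mathbb C)^g$, an $n\times m$ matrix $\Gamma$ and a unitary $U$, write $X\Gamma=(X_1\Gamma,\dots,X_g\Gamma)$, $\Gamma Y=(\Gamma Y_1,\dots,\Gamma Y_g)$, $U^*XU=(U^*X_1U,\dots,U^*X_gU)$ and $X\oplus Y=(X_1\oplus Y_1,\dots,X_g\oplus Y_g)$ (block diagonal). A non-commutative set $\mathcal U\subseteq M(\mathbb C)^g$ is a sequence $(\mathcal U(n))_{n\in\mathbb N}$ with $\mathcal U(n)\subseteq M_n(\mathbb C)^g$ such that $U^*XU\in\mathcal U(n)$ whenever $X\in\mathcal U(n)$ and $U$ is an $n\times n$ unitary, and $X\oplus Y\in\mathcal U(n+m)$ whenever $X\in\mathcal U(n)$, $Y\in\mathcal U(m)$. It is a non-commutative domain if each $\mathcal U(n)$ is open and connected; it contains $0$ if $0\in\mathcal U(n)$ for all $n$. A free map $f:\mathcal U\to M(\mathbb C)^{\tilde g}$ is a sequence of functions $f[n]:\mathcal U(n)\to M_n(\mathbb C)^{\tilde g}$ that respects intertwining maps: whenever $X\in\mathcal U(n)$, $Y\in\mathcal U(m)$, $\Gamma\in\mathbb C^{n\times m}$ and $X\Gamma=\Gamma Y$, then $f[n](X)\Gamma=\Gamma f[m](Y)$; one writes $f(X)$ for $f[n](X)$. For a non-commutative set $\mathcal V\subseteq M(\mathbb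 C)^{\tilde g}$, $f:\mathcal U\to\mathcal V$ means $f[n](\mathcal U(n))\subseteq\mathcal V(n)$ for all $n$, and $f(\mathcal U)=(f[n](\mathcal U(n)))_n$. $f$ is continuous (resp. analytic) if each $f[n]$ is continuous (resp. holomorphic); an analytic free map is a free map on a non-commutative domain with each $f[n]$ analytic. $f:\mathcal U\to\mathcal V$ is proper if each $f[n]:\mathcal U(n)\to\mathcal V(n)$ is proper, i.e. preimages of compact subsets of $\mathcal V(n)$ are compact. *)

theory Defs
  imports "HOL-Analysis.Analysis" "Jordan_Normal_Form.Matrix"
begin

text \<open>A g-tuple of n x n complex matrices is a list of length g of n x n matrices
  (Jordan_Normal_Form matrices). The size n varies inside the statement, so an
  explicit carrier is used.\<close>

definition nc_tuples :: "nat \<Rightarrow> nat \<Rightarrow> complex mat list set" where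
  "nc_tuples g n = {X. length X = g \<and> (\<forall>k<g. X ! k \<in> carrier_mat n n)}"

definition zero_tuple :: "nat \<Rightarrow> nat \<Rightarrow> complex mat list" where
  "zero_tuple g n = replicate g (0\<^sub>m n n)"

definition ctrans :: "complex mat \<Rightarrow> complex mat" where
  "ctrans U = mat (dim_col U) (dim_row U) (\<lambda>(i,j). cnj (U $$ (j,i)))"

definition unitary_mat :: "nat \<Rightarrow> complex mat \<Rightarrow> bool" where
  "unitary_mat n U \<longleftrightarrow> U \<in> carrier_mat n n \<and> ctrans U * U = 1\<^sub>m n \<and> U * ctrans U = 1\<^sub>m n"

definition tuple_conj :: "complex mat \<Rightarrow> complex mat list \<Rightarrow> complex mat list" where
  "tuple_conj U X = map (\<lambda>A. ctrans U * A * U) X"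

definition tuple_dsum :: "complex mat list \<Rightarrow> complex mat list \<Rightarrow> complex mat list" where
  "tuple_dsum X Y = map2 (\<lambda>A B. four_block_mat A (0\<^sub>m (dim_row A) (dim_col B))
                                           (0\<^sub>m (dim_row B) (dim_col A)) B) X Y"

definition tuple_add :: "complex mat list \<Rightarrow> complex mat list \<Rightarrow> complex mat list" where
  "tuple_add X Y = map2 (\<lambda>A B. A + B) X Y"

definition tuple_sub :: "complex mat list \<Rightarrow> complex mat list \<Rightarrow> complex mat list" where
  "tuple_sub X Y = map2 (\<lambda>A B. A - B) X Y"

definition tuple_smult :: "complex \<Rightarrow> complex mat list \<Rightarrow> complex mat list" where
  "tuple_smult c X = map (\<lambda>A. c \<cdot>\<^sub>m A) X"

definition tuple_norm :: "complex mat list \<Rightarrow> real" where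
  "tuple_norm X = sqrt (\<Sum>k<length X. \<Sum>i<dim_row (X ! k). \<Sum>j<dim_col (X ! k).
                          (cmod ((X ! k) $$ (i,j)))\<^sup>2)"

definition nc_top :: "nat \<Rightarrow> nat \<Rightarrow> complex mat list topology" where
  "nc_top g n = topology (\<lambda>S. S \<subseteq> nc_tuples g n \<and>
      (\<forall>X\<in>S. \<exists>e>0. \<forall>Y\<in>nc_tuples g n. tuple_norm (tuple_sub Y X) < e \<longrightarrow> Y \<in> S))"

definition nc_set :: "nat \<Rightarrow> (nat \<Rightarrow> complex mat list set) \<Rightarrow> bool" where
  "nc_set g U \<longleftrightarrow>
     (\<forall>n\<ge>1. U n \<subseteq> nc_tuples g n) \<and>
     (\<forall>n\<ge>1. \<forall>X\<in>U n. \<forall>W. unitary_mat n W \<longrightarrow> tuple_conj W X \<in> U n) \<and>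
     (\<forall>n\<ge>1. \<forall>m\<ge>1. \<forall>X\<in>U n. \<forall>Y\<in>U m. tuple_dsum X Y \<in> U (n + m))"

definition nc_domain :: "nat \<Rightarrow> (nat \<Rightarrow> complex mat list set) \<Rightarrow> bool" where
  "nc_domain g U \<longleftrightarrow> nc_set g U \<and>
     (\<forall>n\<ge>1. openin (nc_top g n) (U n) \<and> connectedin (nc_top g n) (U n))"

definition contains_zero :: "nat \<Rightarrow> (nat \<Rightarrow> complex mat list set) \<Rightarrow> bool" where
  "contains_zero g U \<longleftrightarrow> (\<forall>n\<ge>1. zero_tuple g n \<in> U n)"

definition free_map :: "nat \<Rightarrow> nat \<Rightarrow> (nat \<Rightarrow> complex mat list set)
                       \<Rightarrow> (nat \<Rightarrow> complex mat list \<Rightarrow> complex mat list) \<Rightarrow> bool" where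
  "free_map g g' U f \<longleftrightarrow>
     (\<forall>n\<ge>1. \<forall>X\<in>U n. f n X \<in> nc_tuples g' n) \<and>
     (\<forall>n\<ge>1. \<forall>m\<ge>1. \<forall>X\<in>U n. \<forall>Y\<in>U m. \<forall>\<Gamma>\<in>carrier_mat n m.
        (\<forall>k<g. X ! k * \<Gamma> = \<Gamma> * Y ! k) \<longrightarrow> (\<forall>k<g'. f n X ! k * \<Gamma> = \<Gamma> * f m Y ! k))"

definition maps_into :: "(nat \<Rightarrow> complex mat list set) \<Rightarrow> (nat \<Rightarrow> complex mat list set)
                        \<Rightarrow> (nat \<Rightarrow> complex mat list \<Rightarrow> complex mat list) \<Rightarrow> bool" where
  "maps_into U V f \<longleftrightarrow> (\<forall>n\<ge>1. f n ` U n \<subseteq> V n)"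

definition nc_image :: "(nat \<Rightarrow> complex mat list \<Rightarrow> complex mat list)
                       \<Rightarrow> (nat \<Rightarrow> complex mat list set) \<Rightarrow> nat \<Rightarrow> complex mat list set" where
  "nc_image f U n = f n ` U n"

definition nc_inverse :: "(nat \<Rightarrow> complex mat list \<Rightarrow> complex mat list)
                       \<Rightarrow> (nat \<Rightarrow> complex mat list set) \<Rightarrow> nat \<Rightarrow> complex mat list \<Rightarrow> complex mat list" where
  "nc_inverse f U n = the_inv_into (U n) (f n)"

definition one_to_one :: "(nat \<Rightarrow> complex mat list set)
                         \<Rightarrow> (nat \<Rightarrow> complex mat list \<Rightarrow> complex mat list) \<Rightarrow> bool" where
  "one_to_one U f \<longleftrightarrow> (\<forall>n\<ge>1. inj_on (f n) (U n))"

definition proper_nc :: "nat \<Rightarrow> nat \<Rightarrow> (nat \<Rightarrow> complex mat list set) \<Rightarrow> (nat \<Rightarrow> complex mat list set)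
                        \<Rightarrow> (nat \<Rightarrow> complex mat list \<Rightarrow> complex mat list) \<Rightarrow> bool" where
  "proper_nc g g' U V f \<longleftrightarrow> (\<forall>n\<ge>1. \<forall>K. compactin (subtopology (nc_top g' n) (V n)) K \<longrightarrow>
       compactin (subtopology (nc_top g n) (U n)) {X \<in> U n. f n X \<in> K})"

definition continuous_nc :: "nat \<Rightarrow> nat \<Rightarrow> (nat \<Rightarrow> complex mat list set)
                        \<Rightarrow> (nat \<Rightarrow> complex mat list \<Rightarrow> complex mat list) \<Rightarrow> bool" where
  "continuous_nc g g' U f \<longleftrightarrow>
     (\<forall>n\<ge>1. continuous_map (subtopology (nc_top g n) (U n)) (nc_top g' n) (f n))"

definition tuple_clinear :: "nat \<Rightarrow> nat \<Rightarrow> nat \<Rightarrow> (complex mat list \<Rightarrow> complex mat list) \<Rightarrow> bool" where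
  "tuple_clinear g g' n L \<longleftrightarrow>
     (\<forall>H\<in>nc_tuples g n. L H \<in> nc_tuples g' n) \<and>
     (\<forall>H\<in>nc_tuples g n. \<forall>K\<in>nc_tuples g n. L (tuple_add H K) = tuple_add (L H) (L K)) \<and>
     (\<forall>c. \<forall>H\<in>nc_tuples g n. L (tuple_smult c H) = tuple_smult c (L H))"

definition holomorphic_tuples :: "nat \<Rightarrow> nat \<Rightarrow> nat \<Rightarrow> (complex mat list \<Rightarrow> complex mat list)
                                  \<Rightarrow> complex mat list set \<Rightarrow> bool" where
  "holomorphic_tuples g g' n F S \<longleftrightarrow>
     (\<forall>X\<in>S. \<exists>L. tuple_clinear g g' n L \<and>
        (\<forall>e>0. \<exists>d>0. \<forall>Y\<in>S. tuple_norm (tuple_sub Y X) < d \<longrightarrow>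
            tuple_norm (tuple_sub (tuple_sub (F Y) (F X)) (L (tuple_sub Y X)))
              \<le> e * tuple_norm (tuple_sub Y X)))"

definition analytic_free_map :: "nat \<Rightarrow> nat \<Rightarrow> (nat \<Rightarrow> complex mat list set)
                        \<Rightarrow> (nat \<Rightarrow> complex mat list \<Rightarrow> complex mat list) \<Rightarrow> bool" where
  "analytic_free_map g g' U f \<longleftrightarrow> nc_domain g U \<and> free_map g g' U f \<and>
     (\<forall>n\<ge>1. holomorphic_tuples g g' n (f n) (U n))"

end

(*
  Suppose f(X) G = G f(Y) and put C = X G - G Y.  The block matrix [[X, tC], [0, Y]] is similar to
  X (+) Y via [[1, tG], [0, 1]], so f takes the same value there for every complex t that keeps the
  matrix in U.  A fibre contained in a compact subset of U forces this complex line to be constant,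
  so C = 0: that is injectivity (G = 1) and the freeness of the inverse.

  For part (3), the (1,2) block of f([[X, sH], [0, X]]) is s L(H) with L linear, by intertwining.
  A further similarity expresses b^2 (f(X+H) - f(X) - L(H)) as a block of f at a matrix
  within O(b |H| + |H|) of X (+) X (+) X, where f is bounded by continuity.  Taking b = c / |H| with c small
  shows that L is the derivative, without any complex analysis.  Surjectivity follows from invariance
  of domain, properness and the connectedness of V(n).
*)
theory Submission
  imports Defs "HOL-Homology.Invariance_of_Domain"
begin

text \<open>Openness and direct sums guarantee that a block triangular matrix lies in
  \<open>U\<close> only when its corner is small, so every construction starts from small
  parameters. What happens at size \<open>n\<close> is controlled by \<open>f\<close> at sizes
  \<open>2n\<close> and \<open>3n\<close>; in particular, continuity at size \<open>3n\<close> is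
  what yields differentiability at size \<open>n\<close>.

  The derivative needs three diagonal blocks for the following reason. With diagonal
  \<open>X, Y\<close> and corner \<open>b (Y - X)\<close>, the corner of the value is
  \<open>b (f Y - f X)\<close>; bounding it for \<open>b = c / |H|\<close> gives only a Lipschitz
  estimate. The block bidiagonal matrix with diagonal \<open>X, X, Y\<close> and superdiagonal
  \<open>b H, - b H\<close> has in its far corner a second divided difference, that is, the error of
  the linearisation times \<open>b^2\<close> up to sign. A bound on this corner is a quadratic bound
  on the error.

  The inverse is treated by the same estimate: it is again a free map on an open set, and its
  continuity is a by-product of invariance of domain.\<close>

section \<open>The metric topology on tuples\<close>

definition tuple_entry :: "complex mat list \<Rightarrow> nat \<times> nat \<times> nat \<Rightarrow> complex" where
  "tuple_entry X p = (case p of (k, i, j) \<Rightarrow> X ! k $$ (i, j))"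

definition entry_index :: "nat \<Rightarrow> nat \<Rightarrow> (nat \<times> nat \<times> nat) set" where
  "entry_index g n = {..<g} \<times> {..<n} \<times> {..<n}"

text \<open>Restricting to the index set makes this symmetric on all lists, as the locale
  \<open>Metric_space\<close> demands; \<^const>\<open>tuple_sub\<close> is not, for mismatched shapes.\<close>

definition tuple_dist :: "nat \<Rightarrow> nat \<Rightarrow> complex mat list \<Rightarrow> complex mat list \<Rightarrow> real" where
  "tuple_dist g n X Y = L2_set (\<lambda>p. cmod (tuple_entry X p - tuple_entry Y p)) (entry_index g n)"

lemma finite_entry_index [simp]: "finite (entry_index g n)"
  by (simp add: entry_index_def)

lemma nc_tuples_eqI:
  assumes "X \<in> nc_tuples g n" "Y \<in> nc_tuples g n"
    and "\<And>p. p \<in> entry_index g n \<Longrightarrow> tuple_entry X p = tuple_entry Y p"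
  shows "X = Y"
proof (rule nth_equalityI)
  show "length X = length Y" using assms(1,2) by (simp add: nc_tuples_def)
  fix k assume "k < length X"
  then have k: "k < g" using assms(1) by (simp add: nc_tuples_def)
  then have c: "X ! k \<in> carrier_mat n n" "Y ! k \<in> carrier_mat n n"
    using assms(1,2) by (auto simp: nc_tuples_def)
  show "X ! k = Y ! k"
  proof (rule eq_matI)
    fix i j assume "i < dim_row (Y ! k)" "j < dim_col (Y ! k)"
    then have "(k, i, j) \<in> entry_index g n" using c k by (auto simp: entry_index_def)
    from assms(3)[OF this] show "X ! k $$ (i, j) = Y ! k $$ (i, j)"
      by (simp add: tuple_entry_def)
  qed (use c in auto)
qed

lemma tuple_norm_eq:
  assumes "X \<in> nc_tuples g n"
  shows "tuple_norm X = L2_set (\<lambda>p. cmod (tuple_entry X p)) (entry_index g n)"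
proof -
  have l: "length X = g" and d: "\<And>k. k < g \<Longrightarrow> dim_row (X ! k) = n \<and> dim_col (X ! k) = n"
    using assms by (auto simp: nc_tuples_def)
  have "(\<Sum>k<length X. \<Sum>i<dim_row (X ! k). \<Sum>j<dim_col (X ! k). (cmod (X ! k $$ (i, j)))\<^sup>2)
      = (\<Sum>k<g. \<Sum>i<n. \<Sum>j<n. (cmod (X ! k $$ (i, j)))\<^sup>2)"
    using l d by (intro sum.cong) auto
  also have "\<dots> = (\<Sum>p\<in>entry_index g n. (cmod (tuple_entry X p))\<^sup>2)"
    by (simp add: entry_index_def sum.cartesian_product tuple_entry_def case_prod_beta)
  finally show ?thesis by (simp add: tuple_norm_def L2_set_def)
qed

lemma tuple_sub_nth: "k < length X \<Longrightarrow> k < length Y \<Longrightarrow> tuple_sub X Y ! k = X ! k - Y ! k"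
  by (simp add: tuple_sub_def)

lemma tuple_sub_closed:
  assumes "X \<in> nc_tuples g n" "Y \<in> nc_tuples g n"
  shows "tuple_sub X Y \<in> nc_tuples g n"
  using assms by (auto simp: nc_tuples_def tuple_sub_def minus_carrier_mat)

lemma tuple_entry_sub:
  assumes "X \<in> nc_tuples g n" "Y \<in> nc_tuples g n" "p \<in> entry_index g n"
  shows "tuple_entry (tuple_sub X Y) p = tuple_entry X p - tuple_entry Y p"
  using assms by (auto simp: nc_tuples_def tuple_entry_def entry_index_def tuple_sub_nth)

lemma tuple_norm_sub:
  assumes "X \<in> nc_tuples g n" "Y \<in> nc_tuples g n"
  shows "tuple_norm (tuple_sub X Y) = tuple_dist g n X Y"
  unfolding tuple_norm_eq[OF tuple_sub_closed[OF assms]] tuple_dist_def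
  by (rule L2_set_cong) (simp_all add: tuple_entry_sub[OF assms])

lemma Metric_space_tuples: "Metric_space (nc_tuples g n) (tuple_dist g n)"
proof
  fix X Y Z
  show "0 \<le> tuple_dist g n X Y" by (simp add: tuple_dist_def)
  show "tuple_dist g n X Y = tuple_dist g n Y X" by (simp add: tuple_dist_def norm_minus_commute)
  show "tuple_dist g n X Y = 0 \<longleftrightarrow> X = Y" if "X \<in> nc_tuples g n" "Y \<in> nc_tuples g n"
    using nc_tuples_eqI[OF that] by (auto simp: tuple_dist_def L2_set_eq_0_iff)
  have "tuple_dist g n X Z \<le>
      L2_set (\<lambda>p. cmod (tuple_entry X p - tuple_entry Y p) + cmod (tuple_entry Y p - tuple_entry Z p))
        (entry_index g n)"
    unfolding tuple_dist_def
  proof (rule L2_set_mono)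
    fix p
    show "cmod (tuple_entry X p - tuple_entry Z p)
        \<le> cmod (tuple_entry X p - tuple_entry Y p) + cmod (tuple_entry Y p - tuple_entry Z p)"
      using norm_triangle_ineq[of "tuple_entry X p - tuple_entry Y p" "tuple_entry Y p - tuple_entry Z p"]
      by simp
  qed simp
  also have "\<dots> \<le> tuple_dist g n X Y + tuple_dist g n Y Z"
    unfolding tuple_dist_def by (rule L2_set_triangle_ineq)
  finally show "tuple_dist g n X Z \<le> tuple_dist g n X Y + tuple_dist g n Y Z" .
qed

text \<open>On tuples of the right shape, \<open>tuple_norm\<close> of a difference is
  \<open>tuple_dist\<close>, so the openness predicate inside \<open>nc_top\<close> is that of
  metric balls. This gives access to the metric theory: Hausdorffness, metrizability, continuity by
  balls.\<close>

lemma nc_top_eq_mtopology: "nc_top g n = Metric_space.mtopology (nc_tuples g n) (tuple_dist g n)"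
proof -
  interpret Metric_space "nc_tuples g n" "tuple_dist g n" by (rule Metric_space_tuples)
  have "(S \<subseteq> nc_tuples g n \<and>
      (\<forall>X\<in>S. \<exists>e>0. \<forall>Y\<in>nc_tuples g n. tuple_norm (tuple_sub Y X) < e \<longrightarrow> Y \<in> S)) \<longleftrightarrow>
      (S \<subseteq> nc_tuples g n \<and> (\<forall>X. X \<in> S \<longrightarrow> (\<exists>r>0. mball X r \<subseteq> S)))" for S
  proof (cases "S \<subseteq> nc_tuples g n")
    case True
    have "(\<forall>Y\<in>nc_tuples g n. tuple_norm (tuple_sub Y X) < e \<longrightarrow> Y \<in> S) \<longleftrightarrow> mball X e \<subseteq> S"
      if "X \<in> S" for X e
      using that True by (auto simp: subset_iff tuple_norm_sub commute)
    then show ?thesis using True by auto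
  qed simp
  then show ?thesis unfolding nc_top_def mtopology_def mopen_def by presburger
qed

lemma topspace_nc_top [simp]: "topspace (nc_top g n) = nc_tuples g n"
  by (simp add: nc_top_eq_mtopology Metric_space.topspace_mtopology Metric_space_tuples)

lemma Hausdorff_nc_top: "Hausdorff_space (nc_top g n)"
  by (simp add: nc_top_eq_mtopology Metric_space.Hausdorff_space_mtopology Metric_space_tuples)

lemma openin_nc_top:
  "openin (nc_top g n) S \<longleftrightarrow> S \<subseteq> nc_tuples g n \<and>
     (\<forall>X\<in>S. \<exists>e>0. \<forall>Y\<in>nc_tuples g n. tuple_dist g n Y X < e \<longrightarrow> Y \<in> S)"
proof -
  interpret Metric_space "nc_tuples g n" "tuple_dist g n" by (rule Metric_space_tuples)
  have "mball X e \<subseteq> S \<longleftrightarrow> (\<forall>Y\<in>nc_tuples g n. tuple_dist g n Y X < e \<longrightarrow> Y \<in> S)"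
    if "X \<in> nc_tuples g n" for X e
    using that by (auto simp: commute)
  then have "(\<forall>X. X \<in> S \<longrightarrow> (\<exists>r>0. mball X r \<subseteq> S)) \<longleftrightarrow>
      (\<forall>X\<in>S. \<exists>e>0. \<forall>Y\<in>nc_tuples g n. tuple_dist g n Y X < e \<longrightarrow> Y \<in> S)"
    if "S \<subseteq> nc_tuples g n"
    using that by (simp add: subset_iff Ball_def)
  then show ?thesis
    unfolding nc_top_eq_mtopology openin_mtopology by (rule conj_cong[OF refl])
qed

lemma entry_le_tuple_dist:
  assumes "p \<in> entry_index g n"
  shows "cmod (tuple_entry X p - tuple_entry Y p) \<le> tuple_dist g n X Y"
  unfolding tuple_dist_def by (rule member_le_L2_set) (use assms in auto)

text \<open>A crude l1 bound, which lets estimates be made entry by entry. It is the origin of the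
  cardinalities in the constants of the differentiability proof.\<close>

lemma tuple_dist_le:
  fixes r :: real
  assumes "\<And>p. p \<in> entry_index g n \<Longrightarrow> cmod (tuple_entry X p - tuple_entry Y p) \<le> r"
  shows "tuple_dist g n X Y \<le> card (entry_index g n) * r"
proof -
  have "tuple_dist g n X Y \<le> (\<Sum>p\<in>entry_index g n. cmod (tuple_entry X p - tuple_entry Y p))"
    unfolding tuple_dist_def by (rule L2_set_le_sum) auto
  also have "\<dots> \<le> card (entry_index g n) * r"
    by (rule sum_bounded_above) (rule assms)
  finally show ?thesis .
qed

lemma continuous_map_tuple_entry:
  assumes "p \<in> entry_index g n"
  shows "continuous_map (nc_top g n) euclidean (\<lambda>X. tuple_entry X p)"
  unfolding continuous_map_def
proof (intro conjI allI impI)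
  fix S :: "complex set" assume "openin euclidean S"
  then have S: "open S" by simp
  show "openin (nc_top g n) {X \<in> topspace (nc_top g n). tuple_entry X p \<in> S}"
    unfolding openin_nc_top
  proof (intro conjI ballI)
    fix X assume "X \<in> {X \<in> topspace (nc_top g n). tuple_entry X p \<in> S}"
    then obtain e where "e > 0" "\<And>z. dist z (tuple_entry X p) < e \<Longrightarrow> z \<in> S"
      using S by (auto simp: open_dist)
    then show "\<exists>e>0. \<forall>Y\<in>nc_tuples g n. tuple_dist g n Y X < e \<longrightarrow>
        Y \<in> {X \<in> topspace (nc_top g n). tuple_entry X p \<in> S}"
      using entry_le_tuple_dist[OF assms] by (auto simp: dist_norm) (meson le_less_trans)
  qed auto
qed simp

text \<open>The distance from \<open>F x\<close> is a continuous function of finitely many entries,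
  so preimages of balls are open. Continuity of a tuple-valued map thereby becomes an entrywise
  check.\<close>

lemma continuous_map_into_nc_top:
  assumes "\<And>x. x \<in> topspace T \<Longrightarrow> F x \<in> nc_tuples g n"
    and "\<And>p. p \<in> entry_index g n \<Longrightarrow> continuous_map T euclidean (\<lambda>x. tuple_entry (F x) p)"
  shows "continuous_map T (nc_top g n) F"
proof -
  interpret Metric_space "nc_tuples g n" "tuple_dist g n" by (rule Metric_space_tuples)
  show ?thesis unfolding nc_top_eq_mtopology continuous_map_to_metric
  proof (intro ballI allI impI)
    fix x and e :: real assume x: "x \<in> topspace T" and e: "e > 0"
    have "continuous_map T euclideanreal (\<lambda>y. tuple_dist g n (F y) (F x))"
      unfolding tuple_dist_def L2_set_def
      by (intro continuous_map_sqrt continuous_map_sum continuous_map_real_pow continuous_map_norm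
            continuous_map_diff assms(2)) auto
    then have "openin T {y \<in> topspace T. tuple_dist g n (F y) (F x) \<in> {..<e}}"
      by (rule openin_continuous_map_preimage) simp
    then show "\<exists>U. openin T U \<and> x \<in> U \<and> (\<forall>y\<in>U. F y \<in> mball (F x) e)"
      by (rule_tac exI) (use x e assms(1) in \<open>auto simp: commute\<close>)
  qed
qed

section \<open>Comparison with Euclidean space and invariance of domain\<close>

text \<open>A homeomorphism with Euclidean space, listing the real and imaginary parts of the entries
  in an arbitrary order, transfers invariance of domain.\<close>

lemma nc_top_homeomorphic_Euclidean:
  "nc_top g n homeomorphic_space Euclidean_space (card (entry_index g n \<times> (UNIV :: bool set)))"
proof -
  let ?J = "entry_index g n \<times> (UNIV :: bool set)"
  let ?N = "card ?J"
  obtain b where b: "bij_betw b {0..<?N} ?J"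
    using ex_bij_betw_nat_finite[of ?J] by auto
  define c where "c = the_inv_into {0..<?N} b"
  have cb: "c (b m) = m" if "m < ?N" for m
    using b that by (auto simp: c_def bij_betw_def the_inv_into_f_f)
  have bc: "b (c q) = q" if "q \<in> ?J" for q
    using b that by (auto simp: c_def bij_betw_def f_the_inv_into_f)
  have cN: "c q < ?N" if "q \<in> ?J" for q
    using bij_betw_the_inv_into[OF b] that by (auto simp: c_def bij_betw_def)
  have bJ: "fst (b m) \<in> entry_index g n" if "m < ?N" for m
    using bij_betwE[OF b] that by (simp add: mem_Times_iff)
  \<comment> \<open>The tag \<open>True\<close> marks real parts and \<open>False\<close> imaginary
    parts. The value 0 from index \<open>?N\<close> on matters: points of
    \<open>Euclidean_space\<close> are infinite sequences that vanish there.\<close>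
  define \<phi> where "\<phi> X = (\<lambda>m. if m < ?N then
      (if snd (b m) then Re (tuple_entry X (fst (b m))) else Im (tuple_entry X (fst (b m)))) else 0)" for X
  define \<psi> where "\<psi> x = map (\<lambda>k. Matrix.mat n n (\<lambda>(i, j).
      Complex (x (c ((k, i, j), True))) (x (c ((k, i, j), False))))) [0..<g]" for x :: "nat \<Rightarrow> real"
  have \<psi>_mem: "\<psi> x \<in> nc_tuples g n" for x by (auto simp: \<psi>_def nc_tuples_def)
  have \<psi>_entry: "tuple_entry (\<psi> x) p = Complex (x (c (p, True))) (x (c (p, False)))"
    if "p \<in> entry_index g n" for x p
    using that by (auto simp: \<psi>_def tuple_entry_def entry_index_def)
  have re: "continuous_map T euclideanreal (\<lambda>x. Re (h x))" 
    and im: "continuous_map T euclideanreal (\<lambda>x. Im (h x))"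
    if "continuous_map T euclidean h" for h and T :: "complex mat list topology"
    using continuous_map_compose[OF that, of euclideanreal Re]
      continuous_map_compose[OF that, of euclideanreal Im]
    by (auto simp: o_def continuous_on_Re continuous_on_Im)
  have c\<phi>: "continuous_map (nc_top g n) (Euclidean_space ?N) \<phi>"
    unfolding Euclidean_space_def continuous_map_in_subtopology continuous_map_componentwise_UNIV
  proof (intro conjI allI)
    fix m
    show "continuous_map (nc_top g n) euclideanreal (\<lambda>x. \<phi> x m)"
    proof (cases "m < ?N")
      case True
      show ?thesis 
        using re[OF continuous_map_tuple_entry[OF bJ[OF True]]]
          im[OF continuous_map_tuple_entry[OF bJ[OF True]]] True by (auto simp: \<phi>_def)
    qed (simp add: \<phi>_def)
  qed (auto simp: \<phi>_def)
  have coord: "continuous_map (Euclidean_space ?N) euclideanreal (\<lambda>x. x m)" for m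
    unfolding Euclidean_space_def
    by (intro continuous_map_from_subtopology continuous_map_product_projection) auto
  have c\<psi>: "continuous_map (Euclidean_space ?N) (nc_top g n) \<psi>"
  proof (rule continuous_map_into_nc_top)
    fix p assume p: "p \<in> entry_index g n"
    have "continuous_map (Euclidean_space ?N) euclidean
        (\<lambda>x. complex_of_real (x (c (p, True))) + \<i> * complex_of_real (x (c (p, False))))"
    proof -
      have of: "continuous_map (Euclidean_space ?N) (euclidean :: complex topology)
          (\<lambda>x. h (x m))" if "continuous_on UNIV h" for h m
        using continuous_map_compose[OF coord, of euclidean h m] that by (auto simp: o_def)
      show ?thesis
        by (intro continuous_map_add of continuous_intros)
    qed
    then show "continuous_map (Euclidean_space ?N) euclidean (\<lambda>x. tuple_entry (\<psi> x) p)"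
      using p by (simp add: \<psi>_entry Complex_eq)
  qed (rule \<psi>_mem)
  have "homeomorphic_maps (nc_top g n) (Euclidean_space ?N) \<phi> \<psi>"
    unfolding homeomorphic_maps_def
  proof (intro conjI ballI c\<phi> c\<psi>)
    fix X assume X: "X \<in> topspace (nc_top g n)"
    show "\<psi> (\<phi> X) = X"
    proof (rule nc_tuples_eqI[OF \<psi>_mem])
      fix p assume p: "p \<in> entry_index g n"
      then show "tuple_entry (\<psi> (\<phi> X)) p = tuple_entry X p"
        using bc[of "(p, True)"] bc[of "(p, False)"] cN[of "(p, True)"] cN[of "(p, False)"]
        by (simp add: \<psi>_entry \<phi>_def complex_eq_iff)
    qed (use X in simp)
  next
    fix x assume x: "x \<in> topspace (Euclidean_space ?N)"
    show "\<phi> (\<psi> x) = x"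
    proof
      fix m
      show "\<phi> (\<psi> x) m = x m"
      proof (cases "m < ?N")
        case True
        obtain p v where pv: "b m = (p, v)" by (cases "b m")
        then have "p \<in> entry_index g n" using bJ[OF True] by simp
        then show ?thesis using True pv cb[OF True] by (cases v) (auto simp: \<phi>_def \<psi>_entry)
      next
        case False
        then show ?thesis using x by (auto simp: \<phi>_def Euclidean_space_def)
      qed
    qed
  qed
  then show ?thesis unfolding homeomorphic_space_def by blast
qed

text \<open>Conjugating \<open>f\<close> by the homeomorphism reduces this to the Euclidean case.
  Source and target are the same space \<open>X\<close>; this is how \<open>g = g'\<close> enters
  the third part of the theorem.\<close>

lemma invariance_of_domain_homeomorphic_Euclidean:
  assumes h: "X homeomorphic_space Euclidean_space N"
    and U: "openin X U" and f: "continuous_map (subtopology X U) X f" and inj: "inj_on f U"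
  shows "openin X (f ` U)"
proof -
  obtain \<phi> \<psi> where h: "homeomorphic_maps X (Euclidean_space N) \<phi> \<psi>"
    using h by (auto simp: homeomorphic_space_def)
  let ?E = "Euclidean_space N"
  have c\<phi>: "continuous_map X ?E \<phi>" and c\<psi>: "continuous_map ?E X \<psi>"
    and \<psi>\<phi>: "\<And>x. x \<in> topspace X \<Longrightarrow> \<psi> (\<phi> x) = x"
    using h by (auto simp: homeomorphic_maps_def)
  have UX: "U \<subseteq> topspace X" using U openin_subset by blast
  have om: "homeomorphic_map X ?E \<phi>" using h homeomorphic_map_maps by blast
  have fU: "f ` U \<subseteq> topspace X"
    using continuous_map_image_subset_topspace[OF f] UX by (auto simp: topspace_subtopology Int_absorb1)
  have 1: "openin ?E (\<phi> ` U)"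
    using homeomorphic_map_openness_eq[OF om] U UX by blast
  have \<psi>U: "\<psi> ` \<phi> ` U = U" using UX \<psi>\<phi> by force
  have "openin ?E ((\<phi> \<circ> f \<circ> \<psi>) ` (\<phi> ` U))"
  proof (rule invariance_of_domain_Euclidean_space[OF 1])
    have "continuous_map (subtopology ?E (\<phi> ` U)) (subtopology X U) \<psi>"
      using c\<psi> \<psi>U by (auto simp: continuous_map_in_subtopology continuous_map_from_subtopology)
    then show "continuous_map (subtopology ?E (\<phi> ` U)) ?E (\<phi> \<circ> f \<circ> \<psi>)"
      using continuous_map_compose[OF continuous_map_compose[OF _ f] c\<phi>] by (simp add: o_assoc)
    show "inj_on (\<phi> \<circ> f \<circ> \<psi>) (\<phi> ` U)"
    proof (rule inj_onI)
      fix x y assume "x \<in> \<phi> ` U" "y \<in> \<phi> ` U" and e: "(\<phi> \<circ> f \<circ> \<psi>) x = (\<phi> \<circ> f \<circ> \<psi>) y"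
      then obtain u v where uv: "u \<in> U" "v \<in> U" "x = \<phi> u" "y = \<phi> v" by blast
      then have "\<phi> (f u) = \<phi> (f v)" using e \<psi>\<phi>[of u] \<psi>\<phi>[of v] UX by (auto simp: subset_iff)
      then have "f u = f v" using \<psi>\<phi> fU uv by (metis image_subset_iff)
      then show "x = y" using uv inj by (metis inj_onD)
    qed
  qed
  moreover have "(\<phi> \<circ> f \<circ> \<psi>) ` (\<phi> ` U) = \<phi> ` (f ` U)"
    using \<psi>U by (metis image_comp)
  ultimately show ?thesis using homeomorphic_map_openness_eq[OF om, of "f ` U"] fU by auto
qed

lemma invariance_of_domain_nc_top:
  assumes "openin (nc_top g n) U" "continuous_map (subtopology (nc_top g n) U) (nc_top g n) f"
    and "inj_on f U"
  shows "openin (nc_top g n) (f ` U)"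
  using invariance_of_domain_homeomorphic_Euclidean[OF nc_top_homeomorphic_Euclidean assms] .

section \<open>Block matrix algebra\<close>

lemma one_mat_commute:
  fixes A :: "complex mat"
  assumes "A \<in> carrier_mat n m"
  shows "A * 1\<^sub>m m = 1\<^sub>m n * A"
  using assms by simp

lemma smult_one_mat_commute:
  fixes A :: "complex mat"
  assumes "A \<in> carrier_mat n n"
  shows "A * (c \<cdot>\<^sub>m 1\<^sub>m n) = (c \<cdot>\<^sub>m 1\<^sub>m n) * A"
  using assms mult_smult_distrib[OF assms one_carrier_mat, of c]
    mult_smult_assoc_mat[OF one_carrier_mat assms, of c] by simp

text \<open>The counterpart of \<open>@\<^sub>r\<close> for columns, likewise a four-block matrix
  with empty blocks, so that \<open>mult_four_block_mat\<close> computes its products.\<close>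

definition append_cols_mat :: "complex mat \<Rightarrow> complex mat \<Rightarrow> complex mat" where
  "append_cols_mat A B = four_block_mat A B (0\<^sub>m 0 (dim_col A)) (0\<^sub>m 0 (dim_col B))"

lemma append_cols_mat_carrier:
  assumes "A \<in> carrier_mat n m" "B \<in> carrier_mat n m'"
  shows "append_cols_mat A B \<in> carrier_mat n (m + m')"
  using assms by (auto simp: append_cols_mat_def)

lemma four_block_mat_inj:
  assumes "A \<in> carrier_mat n m" "A' \<in> carrier_mat n m" "B \<in> carrier_mat n m'" "B' \<in> carrier_mat n m'"
    and "C \<in> carrier_mat n' m" "C' \<in> carrier_mat n' m" "D \<in> carrier_mat n' m'" "D' \<in> carrier_mat n' m'"
    and e: "four_block_mat A B C D = four_block_mat A' B' C' D'"
  shows "A = A' \<and> B = B' \<and> C = C' \<and> D = D'"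
proof -
  have ix: "four_block_mat A B C D $$ (i, j) = four_block_mat A' B' C' D' $$ (i, j)" for i j
    using e by simp
  have "A $$ (i, j) = A' $$ (i, j)" if "i < n" "j < m" for i j
    using ix[of i j] that assms(1-8) by auto
  moreover have "B $$ (i, j) = B' $$ (i, j)" if "i < n" "j < m'" for i j
    using ix[of i "m + j"] that assms(1-8) by auto
  moreover have "C $$ (i, j) = C' $$ (i, j)" if "i < n'" "j < m" for i j
    using ix[of "n + i" j] that assms(1-8) by auto
  moreover have "D $$ (i, j) = D' $$ (i, j)" if "i < n'" "j < m'" for i j
    using ix[of "n + i" "m + j"] that assms(1-8) by auto
  ultimately show ?thesis using assms(1-8) by (auto intro!: eq_matI)
qed

lemma append_rows_inj:
  assumes "A \<in> carrier_mat n m" "A' \<in> carrier_mat n m" "B \<in> carrier_mat n' m" "B' \<in> carrier_mat n' m"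
    and "A @\<^sub>r B = A' @\<^sub>r B'"
  shows "A = A' \<and> B = B'"
proof -
  have "four_block_mat A (0\<^sub>m n 0) B (0\<^sub>m n' 0) = four_block_mat A' (0\<^sub>m n 0) B' (0\<^sub>m n' 0)"
    using assms by (auto simp: append_rows_def)
  from four_block_mat_inj[OF assms(1,2) zero_carrier_mat zero_carrier_mat assms(3,4)
      zero_carrier_mat zero_carrier_mat this] show ?thesis by simp
qed

lemma append_cols_mat_inj:
  assumes "A \<in> carrier_mat n m" "A' \<in> carrier_mat n m" "B \<in> carrier_mat n m'" "B' \<in> carrier_mat n m'"
    and "append_cols_mat A B = append_cols_mat A' B'"
  shows "A = A' \<and> B = B'"
proof -
  have "four_block_mat A B (0\<^sub>m 0 m) (0\<^sub>m 0 m') = four_block_mat A' B' (0\<^sub>m 0 m) (0\<^sub>m 0 m')"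
    using assms by (auto simp: append_cols_mat_def)
  from four_block_mat_inj[OF assms(1-4) zero_carrier_mat zero_carrier_mat
      zero_carrier_mat zero_carrier_mat this] show ?thesis by simp
qed

lemma four_block_mat_mult_append_rows:
  fixes A B C D P Q :: "complex mat"
  assumes "A \<in> carrier_mat n p" "B \<in> carrier_mat n q" "C \<in> carrier_mat m p" "D \<in> carrier_mat m q"
    and "P \<in> carrier_mat p r" "Q \<in> carrier_mat q r"
  shows "four_block_mat A B C D * (P @\<^sub>r Q) = (A * P + B * Q) @\<^sub>r (C * P + D * Q)"
proof -
  have "four_block_mat A B C D * four_block_mat P (0\<^sub>m p 0) Q (0\<^sub>m q 0)
      = four_block_mat (A * P + B * Q) (A * 0\<^sub>m p 0 + B * 0\<^sub>m q 0) (C * P + D * Q) (C * 0\<^sub>m p 0 + D * 0\<^sub>m q 0)"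
    by (rule mult_four_block_mat) (use assms in auto)
  also have "A * 0\<^sub>m p 0 + B * 0\<^sub>m q 0 = 0\<^sub>m n 0" using assms by (auto intro!: eq_matI)
  also have "C * 0\<^sub>m p 0 + D * 0\<^sub>m q 0 = 0\<^sub>m m 0" using assms by (auto intro!: eq_matI)
  finally show ?thesis using assms by (simp add: append_rows_def)
qed

lemma append_rows_mult:
  fixes P Q R :: "complex mat"
  assumes "P \<in> carrier_mat n p" "Q \<in> carrier_mat m p" "R \<in> carrier_mat p r"
  shows "(P @\<^sub>r Q) * R = (P * R) @\<^sub>r (Q * R)"
proof -
  \<comment> \<open>Padding \<open>R\<close> with empty blocks makes the product one of four-block
    matrices; the terms that pass through dimension 0 vanish.\<close>
  have R: "R = four_block_mat R (0\<^sub>m p 0) (0\<^sub>m 0 r) (0\<^sub>m 0 0)"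
    using assms by (auto intro!: eq_matI)
  have "four_block_mat P (0\<^sub>m n 0) Q (0\<^sub>m m 0) * four_block_mat R (0\<^sub>m p 0) (0\<^sub>m 0 r) (0\<^sub>m 0 0)
      = four_block_mat (P * R + 0\<^sub>m n 0 * 0\<^sub>m 0 r) (P * 0\<^sub>m p 0 + 0\<^sub>m n 0 * 0\<^sub>m 0 0)
          (Q * R + 0\<^sub>m m 0 * 0\<^sub>m 0 r) (Q * 0\<^sub>m p 0 + 0\<^sub>m m 0 * 0\<^sub>m 0 0)"
    by (rule mult_four_block_mat) (use assms in auto)
  also have "P * R + 0\<^sub>m n 0 * 0\<^sub>m 0 r = P * R"
    using assms by (auto intro!: eq_matI simp: scalar_prod_def)
  also have "Q * R + 0\<^sub>m m 0 * 0\<^sub>m 0 r = Q * R"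
    using assms by (auto intro!: eq_matI simp: scalar_prod_def)
  also have "P * 0\<^sub>m p 0 + 0\<^sub>m n 0 * 0\<^sub>m 0 0 = 0\<^sub>m n 0"
    using assms by (auto intro!: eq_matI)
  also have "Q * 0\<^sub>m p 0 + 0\<^sub>m m 0 * 0\<^sub>m 0 0 = 0\<^sub>m m 0"
    using assms by (auto intro!: eq_matI)
  finally show ?thesis using assms R by (simp add: append_rows_def)
qed

lemma append_cols_mat_mult_four_block:
  fixes A B C D P Q :: "complex mat"
  assumes "A \<in> carrier_mat p n" "B \<in> carrier_mat p m" "C \<in> carrier_mat q n" "D \<in> carrier_mat q m"
    and "P \<in> carrier_mat r p" "Q \<in> carrier_mat r q"
  shows "append_cols_mat P Q * four_block_mat A B C D = append_cols_mat (P * A + Q * C) (P * B + Q * D)"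
proof -
  have "four_block_mat P Q (0\<^sub>m 0 p) (0\<^sub>m 0 q) * four_block_mat A B C D
      = four_block_mat (P * A + Q * C) (P * B + Q * D) (0\<^sub>m 0 p * A + 0\<^sub>m 0 q * C) (0\<^sub>m 0 p * B + 0\<^sub>m 0 q * D)"
    by (rule mult_four_block_mat) (use assms in auto)
  also have "0\<^sub>m 0 p * A + 0\<^sub>m 0 q * C = 0\<^sub>m 0 n" using assms by (auto intro!: eq_matI)
  also have "0\<^sub>m 0 p * B + 0\<^sub>m 0 q * D = 0\<^sub>m 0 m" using assms by (auto intro!: eq_matI)
  finally show ?thesis using assms by (simp add: append_cols_mat_def)
qed

lemma mult_append_cols_mat:
  fixes P Q R :: "complex mat"
  assumes "P \<in> carrier_mat p n" "Q \<in> carrier_mat p m" "R \<in> carrier_mat r p"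
  shows "R * append_cols_mat P Q = append_cols_mat (R * P) (R * Q)"
proof -
  have R: "R = four_block_mat R (0\<^sub>m r 0) (0\<^sub>m 0 p) (0\<^sub>m 0 0)"
    using assms by (auto intro!: eq_matI)
  have "four_block_mat R (0\<^sub>m r 0) (0\<^sub>m 0 p) (0\<^sub>m 0 0) * four_block_mat P Q (0\<^sub>m 0 n) (0\<^sub>m 0 m)
      = four_block_mat (R * P + 0\<^sub>m r 0 * 0\<^sub>m 0 n) (R * Q + 0\<^sub>m r 0 * 0\<^sub>m 0 m)
          (0\<^sub>m 0 p * P + 0\<^sub>m 0 0 * 0\<^sub>m 0 n) (0\<^sub>m 0 p * Q + 0\<^sub>m 0 0 * 0\<^sub>m 0 m)"
    by (rule mult_four_block_mat) (use assms in auto)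
  also have "R * P + 0\<^sub>m r 0 * 0\<^sub>m 0 n = R * P"
    using assms by (auto intro!: eq_matI simp: scalar_prod_def)
  also have "R * Q + 0\<^sub>m r 0 * 0\<^sub>m 0 m = R * Q"
    using assms by (auto intro!: eq_matI simp: scalar_prod_def)
  also have "0\<^sub>m 0 p * P + 0\<^sub>m 0 0 * 0\<^sub>m 0 n = 0\<^sub>m 0 n"
    using assms by (auto intro!: eq_matI)
  also have "0\<^sub>m 0 p * Q + 0\<^sub>m 0 0 * 0\<^sub>m 0 m = 0\<^sub>m 0 m"
    using assms by (auto intro!: eq_matI)
  finally show ?thesis using assms R by (simp add: append_cols_mat_def)
qed

lemma append_cols_mat_mult_append_rows:
  fixes A B P Q :: "complex mat"
  assumes "A \<in> carrier_mat n p" "B \<in> carrier_mat n q" "P \<in> carrier_mat p r" "Q \<in> carrier_mat q r"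
  shows "append_cols_mat A B * (P @\<^sub>r Q) = A * P + B * Q"
proof -
  have "four_block_mat A B (0\<^sub>m 0 p) (0\<^sub>m 0 q) * (P @\<^sub>r Q)
      = (A * P + B * Q) @\<^sub>r (0\<^sub>m 0 p * P + 0\<^sub>m 0 q * Q)"
    by (rule four_block_mat_mult_append_rows) (use assms in auto)
  also have "\<dots> = A * P + B * Q" using assms by (auto intro!: eq_matI simp: append_rows_def)
  finally show ?thesis using assms by (simp add: append_cols_mat_def)
qed

section \<open>Block triangular tuples\<close>

definition rect_tuples :: "nat \<Rightarrow> nat \<Rightarrow> nat \<Rightarrow> complex mat list set" where
  "rect_tuples g n m = {C. length C = g \<and> (\<forall>k<g. C ! k \<in> carrier_mat n m)}"

lemma nc_tuples_rect: "nc_tuples g n = rect_tuples g n n"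
  by (simp add: nc_tuples_def rect_tuples_def)

lemma nc_tuples_nth: "X \<in> nc_tuples g n \<Longrightarrow> k < g \<Longrightarrow> X ! k \<in> carrier_mat n n"
  by (simp add: nc_tuples_def)

lemma rect_tuples_nth: "X \<in> rect_tuples g n m \<Longrightarrow> k < g \<Longrightarrow> X ! k \<in> carrier_mat n m"
  by (simp add: rect_tuples_def)

definition tuple_tri :: "complex mat list \<Rightarrow> complex mat list \<Rightarrow> complex mat list \<Rightarrow> complex mat list" where
  "tuple_tri X C Y = map (\<lambda>k. four_block_mat (X ! k) (C ! k) (0\<^sub>m (dim_row (Y ! k)) (dim_col (X ! k))) (Y ! k))
     [0..<length X]"

definition corner :: "nat \<Rightarrow> nat \<Rightarrow> complex mat list \<Rightarrow> complex mat list" where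
  "corner n m T = map (\<lambda>A. Matrix.mat n m (\<lambda>(i, j). A $$ (i, n + j))) T"

lemma tuple_tri_nth:
  assumes "X \<in> nc_tuples g n" "Y \<in> nc_tuples g m" "k < g"
  shows "tuple_tri X C Y ! k = four_block_mat (X ! k) (C ! k) (0\<^sub>m m n) (Y ! k)"
proof -
  have "length X = g" using assms(1) by (simp add: nc_tuples_def)
  then show ?thesis
    using nc_tuples_nth[OF assms(1,3)] nc_tuples_nth[OF assms(2,3)] assms(3) by (simp add: tuple_tri_def)
qed

lemma tuple_tri_closed:
  assumes "X \<in> nc_tuples g n" "Y \<in> nc_tuples g m"
  shows "tuple_tri X C Y \<in> nc_tuples g (n + m)"
  using assms by (auto simp: tuple_tri_def nc_tuples_def)

lemma tuple_dsum_eq_tri: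
  assumes "X \<in> nc_tuples g n" "Y \<in> nc_tuples g m"
  shows "tuple_dsum X Y = tuple_tri X (replicate g (0\<^sub>m n m)) Y"
proof (rule nth_equalityI)
  have l: "length X = g" "length Y = g" using assms by (auto simp: nc_tuples_def)
  show "length (tuple_dsum X Y) = length (tuple_tri X (replicate g (0\<^sub>m n m)) Y)"
    using l by (simp add: tuple_dsum_def tuple_tri_def)
  fix k assume "k < length (tuple_dsum X Y)"
  then have k: "k < g" using l by (simp add: tuple_dsum_def)
  show "tuple_dsum X Y ! k = tuple_tri X (replicate g (0\<^sub>m n m)) Y ! k"
    unfolding tuple_tri_nth[OF assms k]
    using k l nc_tuples_nth[OF assms(1) k] nc_tuples_nth[OF assms(2) k] by (simp add: tuple_dsum_def)
qed

lemma corner_nth: "k < length T \<Longrightarrow> corner n m T ! k = Matrix.mat n m (\<lambda>(i, j). T ! k $$ (i, n + j))"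
  by (simp add: corner_def)

lemma corner_closed: "length T = g \<Longrightarrow> corner n m T \<in> rect_tuples g n m"
  by (auto simp: corner_def rect_tuples_def)

lemma four_block_mat_split:
  assumes "A \<in> carrier_mat (n + m) (p + q)"
  obtains A1 A2 A3 A4 where "A1 \<in> carrier_mat n p" "A2 \<in> carrier_mat n q"
    "A3 \<in> carrier_mat m p" "A4 \<in> carrier_mat m q" "A = four_block_mat A1 A2 A3 A4"
proof -
  obtain A1 A2 A3 A4 where s: "split_block A n p = (A1, A2, A3, A4)" by (metis prod_cases4)
  have d: "dim_row A = n + m" "dim_col A = p + q" using assms by auto
  show ?thesis using split_block[OF s d] that by blast
qed

section \<open>Free maps at block triangular arguments\<close>

text \<open>The target is all of \<open>nc_tuples\<close>, with no \<open>V\<close> fixed, so that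
  the same context serves both \<open>f\<close> on \<open>U\<close> and its inverse on
  \<open>V\<close>.\<close>

locale nc_free_map =
  fixes g g' :: nat and U :: "nat \<Rightarrow> complex mat list set"
    and f :: "nat \<Rightarrow> complex mat list \<Rightarrow> complex mat list"
  assumes nc: "nc_set g U" and free: "free_map g g' U f"
begin

lemma domain_closed: "n \<ge> 1 \<Longrightarrow> X \<in> U n \<Longrightarrow> X \<in> nc_tuples g n"
  using nc by (auto simp: nc_set_def)

lemma image_closed: "n \<ge> 1 \<Longrightarrow> X \<in> U n \<Longrightarrow> f n X \<in> nc_tuples g' n"
  using free by (auto simp: free_map_def)

lemma intertwine:
  assumes "n \<ge> 1" "m \<ge> 1" "X \<in> U n" "Y \<in> U m" "\<Gamma> \<in> carrier_mat n m"
    and "\<And>k. k < g \<Longrightarrow> X ! k * \<Gamma> = \<Gamma> * Y ! k" "k < g'"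
  shows "f n X ! k * \<Gamma> = \<Gamma> * f m Y ! k"
  using free assms unfolding free_map_def by blast

text \<open>The block column \<open>(1, 0)\<close> intertwines the triangular tuple with
  \<open>X\<close>, which determines the left block column of the value. The block row
  \<open>(0, 1)\<close> intertwines \<open>Y\<close> with the triangular tuple, which determines the
  bottom block row. Only the corner remains unknown.\<close>

lemma tri_image:
  assumes n: "n \<ge> 1" and m: "m \<ge> 1" and X: "X \<in> U n" and Y: "Y \<in> U m"
    and C: "C \<in> rect_tuples g n m" and T: "tuple_tri X C Y \<in> U (n + m)"
  shows "f (n + m) (tuple_tri X C Y)
       = tuple_tri (f n X) (corner n m (f (n + m) (tuple_tri X C Y))) (f m Y)"
proof (rule nth_equalityI)
  let ?T = "tuple_tri X C Y" and ?F = "f (n + m) (tuple_tri X C Y)"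
  have nm: "n + m \<ge> 1" using n by simp
  note fX = image_closed[OF n X] and fY = image_closed[OF m Y] and F = image_closed[OF nm T]
  note cX = domain_closed[OF n X] and cY = domain_closed[OF m Y]
  show "length ?F = length (tuple_tri (f n X) (corner n m ?F) (f m Y))"
    using F fX by (simp add: nc_tuples_def tuple_tri_def)
  fix k assume "k < length ?F"
  then have k: "k < g'" using F by (simp add: nc_tuples_def)
  then have "?F ! k \<in> carrier_mat (n + m) (n + m)" using F by (simp add: nc_tuples_def)
  then obtain A1 A2 A3 A4 where A: "A1 \<in> carrier_mat n n" "A2 \<in> carrier_mat n m"
    "A3 \<in> carrier_mat m n" "A4 \<in> carrier_mat m m" and e: "?F ! k = four_block_mat A1 A2 A3 A4"
    by (rule four_block_mat_split)
  have fXk: "f n X ! k \<in> carrier_mat n n" and fYk: "f m Y ! k \<in> carrier_mat m m"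
    using fX fY k by (auto simp: nc_tuples_def)
  have c1: "1\<^sub>m n @\<^sub>r 0\<^sub>m m n \<in> carrier_mat (n + m) n" by (rule carrier_append_rows) auto
  have c2: "append_cols_mat (0\<^sub>m m n) (1\<^sub>m m) \<in> carrier_mat m (n + m)"
    by (rule append_cols_mat_carrier) auto
  have "?F ! k * (1\<^sub>m n @\<^sub>r 0\<^sub>m m n) = (1\<^sub>m n @\<^sub>r 0\<^sub>m m n) * f n X ! k"
  proof (rule intertwine[OF nm n T X c1 _ k])
    fix l assume l: "l < g"
    have "X ! l \<in> carrier_mat n n" "Y ! l \<in> carrier_mat m m" "C ! l \<in> carrier_mat n m"
      using cX cY C l by (auto simp: nc_tuples_def rect_tuples_def)
    then show "?T ! l * (1\<^sub>m n @\<^sub>r 0\<^sub>m m n) = (1\<^sub>m n @\<^sub>r 0\<^sub>m m n) * X ! l"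
      unfolding tuple_tri_nth[OF cX cY l]
      by (subst four_block_mat_mult_append_rows) (auto simp: append_rows_mult[of _ n n _ m _ n])
  qed
  then have "A1 @\<^sub>r A3 = f n X ! k @\<^sub>r 0\<^sub>m m n"
    unfolding e using A fXk
    by (subst (asm) four_block_mat_mult_append_rows) (auto simp: append_rows_mult[of _ n n _ m _ n])
  then have 1: "A1 = f n X ! k" "A3 = 0\<^sub>m m n"
    using append_rows_inj[OF A(1) fXk A(3) zero_carrier_mat] by auto
  have "f m Y ! k * append_cols_mat (0\<^sub>m m n) (1\<^sub>m m) = append_cols_mat (0\<^sub>m m n) (1\<^sub>m m) * ?F ! k"
  proof (rule intertwine[OF m nm Y T c2 _ k])
    fix l assume l: "l < g"
    have "X ! l \<in> carrier_mat n n" "Y ! l \<in> carrier_mat m m" "C ! l \<in> carrier_mat n m"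
      using cX cY C l by (auto simp: nc_tuples_def rect_tuples_def)
    then show "Y ! l * append_cols_mat (0\<^sub>m m n) (1\<^sub>m m) = append_cols_mat (0\<^sub>m m n) (1\<^sub>m m) * ?T ! l"
      unfolding tuple_tri_nth[OF cX cY l]
      by (subst append_cols_mat_mult_four_block) (auto simp: mult_append_cols_mat[of _ m n _ m _ m])
  qed
  then have "append_cols_mat (0\<^sub>m m n) (f m Y ! k) = append_cols_mat A3 A4"
    unfolding e using A fYk
    by (subst (asm) append_cols_mat_mult_four_block) (auto simp: mult_append_cols_mat[of _ m n _ m _ m])
  then have 2: "f m Y ! k = A4"
    using append_cols_mat_inj[OF zero_carrier_mat A(3) fYk A(4)] by auto
  have "corner n m ?F ! k = A2"
    using F k A by (auto simp: corner_nth nc_tuples_def e intro!: eq_matI)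
  then show "?F ! k = tuple_tri (f n X) (corner n m ?F) (f m Y) ! k"
    unfolding tuple_tri_nth[OF fX fY k] using e 1 2 by simp
qed

text \<open>This is the intertwining property for the upper triangular matrix with rows
  \<open>(G1, G2)\<close> and \<open>(0, G3)\<close>: the three equations are the blocks of the
  hypothesis, and the conclusion is the corner block of the result. The identities below for corners
  of \<open>f\<close> come from choices of \<open>G1\<close>, \<open>G2\<close>,
  \<open>G3\<close>.\<close>

lemma tri_intertwine:
  assumes n: "n \<ge> 1" and m: "m \<ge> 1" and n': "n' \<ge> 1" and m': "m' \<ge> 1"
    and X: "X \<in> U n" and Y: "Y \<in> U m" and X': "X' \<in> U n'" and Y': "Y' \<in> U m'"
    and C: "C \<in> rect_tuples g n m" and C': "C' \<in> rect_tuples g n' m'"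
    and T: "tuple_tri X C Y \<in> U (n + m)" and T': "tuple_tri X' C' Y' \<in> U (n' + m')"
    and G1: "G1 \<in> carrier_mat n n'" and G2: "G2 \<in> carrier_mat n m'" and G3: "G3 \<in> carrier_mat m m'"
    and e1: "\<And>k. k < g \<Longrightarrow> X ! k * G1 = G1 * X' ! k"
    and e2: "\<And>k. k < g \<Longrightarrow> X ! k * G2 + C ! k * G3 = G1 * C' ! k + G2 * Y' ! k"
    and e3: "\<And>k. k < g \<Longrightarrow> Y ! k * G3 = G3 * Y' ! k"
    and k: "k < g'"
  shows "f n X ! k * G2 + corner n m (f (n + m) (tuple_tri X C Y)) ! k * G3
       = G1 * corner n' m' (f (n' + m') (tuple_tri X' C' Y')) ! k + G2 * f m' Y' ! k"
proof -
  let ?G = "four_block_mat G1 G2 (0\<^sub>m m n') G3"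
  let ?F = "f (n + m) (tuple_tri X C Y)" and ?F' = "f (n' + m') (tuple_tri X' C' Y')"
  have nm: "n + m \<ge> 1" "n' + m' \<ge> 1" using n n' by auto
  note cX = domain_closed[OF n X] and cY = domain_closed[OF m Y]
    and cX' = domain_closed[OF n' X'] and cY' = domain_closed[OF m' Y']
  note fX = image_closed[OF n X] and fY = image_closed[OF m Y]
    and fX' = image_closed[OF n' X'] and fY' = image_closed[OF m' Y']
  have lF: "length ?F = g'" "length ?F' = g'"
    using image_closed[OF nm(1) T] image_closed[OF nm(2) T'] by (auto simp: nc_tuples_def)
  have prod: "four_block_mat A B (0\<^sub>m m n) D * ?G
      = four_block_mat (A * G1) (A * G2 + B * G3) (0\<^sub>m m n') (D * G3)"
    if "A \<in> carrier_mat n n" "B \<in> carrier_mat n m" "D \<in> carrier_mat m m" for A B D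
    by (subst mult_four_block_mat) (use that G1 G2 G3 in auto)
  have prod': "?G * four_block_mat A B (0\<^sub>m m' n') D
      = four_block_mat (G1 * A) (G1 * B + G2 * D) (0\<^sub>m m n') (G3 * D)"
    if "A \<in> carrier_mat n' n'" "B \<in> carrier_mat n' m'" "D \<in> carrier_mat m' m'" for A B D
    by (subst mult_four_block_mat) (use that G1 G2 G3 in auto)
  have "?F ! k * ?G = ?G * ?F' ! k"
  proof (rule intertwine[OF nm T T' _ _ k])
    show "?G \<in> carrier_mat (n + m) (n' + m')" using G1 G3 by auto
    fix l assume l: "l < g"
    have c: "X ! l \<in> carrier_mat n n" "Y ! l \<in> carrier_mat m m" "C ! l \<in> carrier_mat n m"
      "X' ! l \<in> carrier_mat n' n'" "Y' ! l \<in> carrier_mat m' m'" "C' ! l \<in> carrier_mat n' m'"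
      using cX cY C cX' cY' C' l by (auto simp: nc_tuples_def rect_tuples_def)
    show "tuple_tri X C Y ! l * ?G = ?G * tuple_tri X' C' Y' ! l"
      unfolding tuple_tri_nth[OF cX cY l] tuple_tri_nth[OF cX' cY' l]
        prod[OF c(1,3,2)] prod'[OF c(4,6,5)] using e1[OF l] e2[OF l] e3[OF l] by simp
  qed
  then have *: "tuple_tri (f n X) (corner n m ?F) (f m Y) ! k * ?G
      = ?G * tuple_tri (f n' X') (corner n' m' ?F') (f m' Y') ! k"
    using tri_image[OF n m X Y C T] tri_image[OF n' m' X' Y' C' T'] by simp
  have c: "f n X ! k \<in> carrier_mat n n" "f m Y ! k \<in> carrier_mat m m" "corner n m ?F ! k \<in> carrier_mat n m"
    "f n' X' ! k \<in> carrier_mat n' n'" "f m' Y' ! k \<in> carrier_mat m' m'" "corner n' m' ?F' ! k \<in> carrier_mat n' m'"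
    using fX fY fX' fY' lF k by (auto simp: nc_tuples_def corner_nth)
  show ?thesis
    using * unfolding tuple_tri_nth[OF fX fY k] tuple_tri_nth[OF fX' fY' k]
      prod[OF c(1,3,2)] prod'[OF c(4,6,5)]
    by (rule four_block_mat_inj[THEN conjunct2, THEN conjunct1, rotated -1])
      (use c G1 G2 G3 in auto)
qed

lemma dsum_mem:
  assumes "n \<ge> 1" "m \<ge> 1" "X \<in> U n" "Y \<in> U m"
  shows "tuple_tri X (replicate g (0\<^sub>m n m)) Y \<in> U (n + m)"
proof -
  have "tuple_dsum X Y \<in> U (n + m)" using nc assms unfolding nc_set_def by blast
  then show ?thesis
    unfolding tuple_dsum_eq_tri[OF domain_closed[OF assms(1,3)] domain_closed[OF assms(2,4)]] .
qed

text \<open>The corner of \<open>f (X \<oplus> Y)\<close> vanishes since \<open>X \<oplus> Y\<close> commutes with \<open>diag(1, 2)\<close>.\<close>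

lemma corner_dsum:
  assumes n: "n \<ge> 1" and m: "m \<ge> 1" and X: "X \<in> U n" and Y: "Y \<in> U m" and k: "k < g'"
  shows "corner n m (f (n + m) (tuple_tri X (replicate g (0\<^sub>m n m)) Y)) ! k = 0\<^sub>m n m"
proof -
  let ?D = "corner n m (f (n + m) (tuple_tri X (replicate g (0\<^sub>m n m)) Y)) ! k"
  have T: "tuple_tri X (replicate g (0\<^sub>m n m)) Y \<in> U (n + m)" by (rule dsum_mem) fact+
  have C: "replicate g (0\<^sub>m n m) \<in> rect_tuples g n m" by (simp add: rect_tuples_def)
  have c: "?D \<in> carrier_mat n m" "f n X ! k \<in> carrier_mat n n" "f m Y ! k \<in> carrier_mat m m"
    using corner_closed[of "f (n + m) (tuple_tri X (replicate g (0\<^sub>m n m)) Y)" g' n m]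
      image_closed[OF _ T] image_closed[OF n X] image_closed[OF m Y] n k
    by (auto simp: nc_tuples_def rect_tuples_def)
  have cXY: "X ! l \<in> carrier_mat n n" "Y ! l \<in> carrier_mat m m" if "l < g" for l
    using domain_closed[OF n X] domain_closed[OF m Y] that by (auto simp: nc_tuples_def)
  have "f n X ! k * 0\<^sub>m n m + ?D * (2 \<cdot>\<^sub>m 1\<^sub>m m) = 1\<^sub>m n * ?D + 0\<^sub>m n m * f m Y ! k"
  proof (rule tri_intertwine[OF n m n m X Y X Y C C T T _ _ _ _ _ _ k])
    fix l assume l: "l < g"
    note c = cXY[OF l]
    show "X ! l * 1\<^sub>m n = 1\<^sub>m n * X ! l" by (rule one_mat_commute) (rule c)
    show "Y ! l * (2 \<cdot>\<^sub>m 1\<^sub>m m) = 2 \<cdot>\<^sub>m 1\<^sub>m m * Y ! l"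
      by (rule smult_one_mat_commute) (rule c)
    show "X ! l * 0\<^sub>m n m + replicate g (0\<^sub>m n m) ! l * (2 \<cdot>\<^sub>m 1\<^sub>m m)
        = 1\<^sub>m n * replicate g (0\<^sub>m n m) ! l + 0\<^sub>m n m * Y ! l"
      using c l by (auto intro!: eq_matI)
  qed auto
  then have e: "2 \<cdot>\<^sub>m ?D = ?D" using c mult_smult_distrib[OF c(1) one_carrier_mat, of 2] by simp
  show ?thesis
  proof (rule eq_matI)
    fix i j assume "i < dim_row (0\<^sub>m n m :: complex mat)" "j < dim_col (0\<^sub>m n m :: complex mat)"
    then have "2 * ?D $$ (i, j) = ?D $$ (i, j)" using c arg_cong[OF e, of "\<lambda>A. A $$ (i, j)"] by auto
    then show "?D $$ (i, j) = (0\<^sub>m n m :: complex mat) $$ (i, j)" 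
      using \<open>i < _\<close> \<open>j < _\<close> by auto
  qed (use c in auto)
qed

text \<open>If \<open>f X G = G f Y\<close> and \<open>C = X G - G Y\<close>, then the matrix with rows \<open>(X, t C)\<close> and \<open>(0, Y)\<close> is
  similar to \<open>X \<oplus> Y\<close> via the matrix with rows \<open>(1, t G)\<close> and \<open>(0, 1)\<close>, so \<open>f\<close> is constant along
  this complex line.\<close>

lemma constant_on_line:
  assumes n: "n \<ge> 1" and m: "m \<ge> 1" and X: "X \<in> U n" and Y: "Y \<in> U m"
    and G: "G \<in> carrier_mat n m"
    and fG: "\<And>k. k < g' \<Longrightarrow> f n X ! k * G = G * f m Y ! k"
    and C: "C = map (\<lambda>k. X ! k * G - G * Y ! k) [0..<g]"
    and T: "tuple_tri X (tuple_smult t C) Y \<in> U (n + m)"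
  shows "f (n + m) (tuple_tri X (tuple_smult t C) Y) = f (n + m) (tuple_tri X (replicate g (0\<^sub>m n m)) Y)"
proof -
  let ?Z = "replicate g (0\<^sub>m n m) :: complex mat list"
  have T0: "tuple_tri X ?Z Y \<in> U (n + m)" by (rule dsum_mem) fact+
  have Z: "?Z \<in> rect_tuples g n m" by (simp add: rect_tuples_def)
  have cXY: "X ! l \<in> carrier_mat n n" "Y ! l \<in> carrier_mat m m" if "l < g" for l
    using domain_closed[OF n X] domain_closed[OF m Y] that by (auto simp: nc_tuples_def)
  have tC: "tuple_smult t C \<in> rect_tuples g n m"
    unfolding C tuple_smult_def rect_tuples_def
  proof (intro CollectI conjI allI impI)
    fix l assume l: "l < g"
    have "X ! l * G \<in> carrier_mat n m" "G * Y ! l \<in> carrier_mat n m" using cXY[OF l] G by auto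
    then show "map ((\<cdot>\<^sub>m) t) (map (\<lambda>k. X ! k * G - G * Y ! k) [0..<g]) ! l \<in> carrier_mat n m"
      using l by (simp add: minus_carrier_mat)
  qed simp
  let ?F = "f (n + m) (tuple_tri X (tuple_smult t C) Y)" and ?E = "f (n + m) (tuple_tri X ?Z Y)"
  have nm: "n + m \<ge> 1" using n by simp
  have lF: "length ?F = g'" "length ?E = g'"
    using image_closed[OF nm T] image_closed[OF nm T0] by (auto simp: nc_tuples_def)
  have "corner n m ?F ! k = corner n m ?E ! k" if k: "k < g'" for k
  proof -
    have c: "corner n m ?F ! k \<in> carrier_mat n m" "f n X ! k \<in> carrier_mat n n" "f m Y ! k \<in> carrier_mat m m"
      using lF image_closed[OF n X] image_closed[OF m Y] k by (auto simp: nc_tuples_def corner_nth)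
    \<comment> \<open>The similarity has \<open>G1\<close> and \<open>G3\<close> equal to the
      identity and \<open>G2 = t G\<close>. Its corner equation reads
      \<open>X (t G) = t C + (t G) Y\<close>, which is the definition of \<open>C\<close> multiplied
      by \<open>t\<close>.\<close>
    have "f n X ! k * (t \<cdot>\<^sub>m G) + corner n m ?E ! k * 1\<^sub>m m
        = 1\<^sub>m n * corner n m ?F ! k + (t \<cdot>\<^sub>m G) * f m Y ! k"
    proof (rule tri_intertwine[OF n m n m X Y X Y Z tC T0 T _ _ _ _ _ _ k])
      fix l assume l: "l < g"
      show "X ! l * (t \<cdot>\<^sub>m G) + ?Z ! l * 1\<^sub>m m = 1\<^sub>m n * tuple_smult t C ! l + t \<cdot>\<^sub>m G * Y ! l"
        using cXY[OF l] G l
        by (auto simp: C tuple_smult_def mult_smult_distrib mult_smult_assoc_mat[OF G] algebra_simps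
            intro!: eq_matI)
    qed (rule one_mat_commute[OF cXY(1)] one_mat_commute[OF cXY(2)] one_carrier_mat
        smult_carrier_mat[OF G] | assumption)+
    moreover have "f n X ! k * (t \<cdot>\<^sub>m G) = t \<cdot>\<^sub>m G * f m Y ! k"
      using c G fG[OF k] mult_smult_distrib[OF c(2) G] mult_smult_assoc_mat[OF G c(3)] by simp
    ultimately have "t \<cdot>\<^sub>m G * f m Y ! k + 0\<^sub>m n m = corner n m ?F ! k + t \<cdot>\<^sub>m G * f m Y ! k"
      unfolding corner_dsum[OF n m X Y k] using c by simp
    then have e: "(t \<cdot>\<^sub>m G * f m Y ! k + 0\<^sub>m n m) $$ (i, j) = (corner n m ?F ! k + t \<cdot>\<^sub>m G * f m Y ! k) $$ (i, j)" for i j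
      by simp
    have d: "t \<cdot>\<^sub>m G * f m Y ! k \<in> carrier_mat n m"
      by (rule mult_carrier_mat[OF smult_carrier_mat[OF G] c(3)])
    have "corner n m ?F ! k = 0\<^sub>m n m"
    proof (rule eq_matI)
      fix i j assume "i < dim_row (0\<^sub>m n m :: complex mat)" "j < dim_col (0\<^sub>m n m :: complex mat)"
      then have "i < n" "j < m" by auto
      then show "corner n m ?F ! k $$ (i, j) = 0\<^sub>m n m $$ (i, j)"
        using e[of i j] c d by (simp del: index_mult_mat)
    qed (use c in auto)
    then show ?thesis unfolding corner_dsum[OF n m X Y k] .
  qed
  then have "corner n m ?F = corner n m ?E"
    using lF by (intro nth_equalityI) (auto simp: corner_def)
  then show ?thesis using tri_image[OF n m X Y tC T] tri_image[OF n m X Y Z T0] by simp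
qed

end

section \<open>Complex lines of triangular tuples and reflection of intertwiners\<close>

lemma tuple_entry_tri:
  assumes X: "X \<in> nc_tuples g n" and Y: "Y \<in> nc_tuples g m" and k: "k < g" "i < n + m" "j < n + m"
  shows "tuple_entry (tuple_tri X C Y) (k, i, j) =
    (if i < n then if j < n then X ! k $$ (i, j) else C ! k $$ (i, j - n)
     else if j < n then 0 else Y ! k $$ (i - n, j - n))"
  unfolding tuple_entry_def prod.case tuple_tri_nth[OF X Y k(1)]
  using nc_tuples_nth[OF X k(1)] nc_tuples_nth[OF Y k(1)] k(2,3) by auto

lemma tuple_smult_rect:
  assumes "C \<in> rect_tuples g n m"
  shows "tuple_smult t C \<in> rect_tuples g n m"
  using assms by (auto simp: tuple_smult_def rect_tuples_def)

lemma tuple_smult_nth: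
  assumes "C \<in> rect_tuples g n m" "k < g"
  shows "tuple_smult t C ! k = t \<cdot>\<^sub>m C ! k"
  using assms by (simp add: tuple_smult_def rect_tuples_def)

lemma tuple_smult_zero:
  assumes "C \<in> rect_tuples g n m"
  shows "tuple_smult 0 C = replicate g (0\<^sub>m n m)"
proof (rule nth_equalityI)
  show "length (tuple_smult 0 C) = length (replicate g (0\<^sub>m n m :: complex mat))"
    using assms by (simp add: tuple_smult_def rect_tuples_def)
  fix k assume "k < length (tuple_smult 0 C)"
  then have k: "k < g" using assms by (simp add: tuple_smult_def rect_tuples_def)
  then show "tuple_smult 0 C ! k = replicate g (0\<^sub>m n m) ! k"
    using rect_tuples_nth[OF assms k] by (auto simp: tuple_smult_nth[OF assms k] intro!: eq_matI)
qed

lemma minus_mat_eq_zeroD: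
  fixes A B :: "complex mat"
  assumes "A \<in> carrier_mat n m" "B \<in> carrier_mat n m" "A - B = 0\<^sub>m n m"
  shows "A = B"
proof (rule eq_matI)
  fix i j assume "i < dim_row B" "j < dim_col B"
  then show "A $$ (i, j) = B $$ (i, j)"
    using assms(1,2) arg_cong[OF assms(3), of "\<lambda>M. M $$ (i, j)"] by auto
qed (use assms in auto)

lemma smult_smult_mat_commute:
  fixes A :: "complex mat"
  shows "s \<cdot>\<^sub>m (t \<cdot>\<^sub>m A) = t \<cdot>\<^sub>m (s \<cdot>\<^sub>m A)"
  by (auto intro!: eq_matI)

lemma one_smult_mat: "1 \<cdot>\<^sub>m A = (A :: complex mat)"
  by (auto intro!: eq_matI)

lemma continuous_map_tri:
  assumes X: "X \<in> nc_tuples g n" and Y: "Y \<in> nc_tuples g m" and C: "C \<in> rect_tuples g n m"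
  shows "continuous_map euclidean (nc_top g (n + m)) (\<lambda>t. tuple_tri X (tuple_smult t C) Y)"
proof (rule continuous_map_into_nc_top)
  show "tuple_tri X (tuple_smult t C) Y \<in> nc_tuples g (n + m)" for t
    by (rule tuple_tri_closed[OF X Y])
  fix p assume "p \<in> entry_index g (n + m)"
  then obtain k i j where p: "p = (k, i, j)" and kij: "k < g" "i < n + m" "j < n + m"
    by (auto simp: entry_index_def)
  have "tuple_smult t C ! k $$ (i, j - n) = t * C ! k $$ (i, j - n)" if "i < n" "\<not> j < n" for t
    using rect_tuples_nth[OF C kij(1)] that kij by (auto simp: tuple_smult_nth[OF C kij(1)])
  then show "continuous_map euclidean euclidean (\<lambda>t. tuple_entry (tuple_tri X (tuple_smult t C) Y) p)"
    unfolding p tuple_entry_tri[OF X Y kij]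
    by (cases "i < n"; cases "j < n") (auto intro!: continuous_intros)
qed

text \<open>The preceding identities are pure algebra. Openness supplies the small nonzero
  parameters \<open>t\<close> to which they are applied.\<close>

locale open_nc_free_map = nc_free_map +
  assumes open_domain: "n \<ge> 1 \<Longrightarrow> openin (nc_top g n) (U n)"
begin

lemma open_line:
  assumes n: "n \<ge> 1" and m: "m \<ge> 1" and X: "X \<in> U n" and Y: "Y \<in> U m" and C: "C \<in> rect_tuples g n m"
  shows "open {t. tuple_tri X (tuple_smult t C) Y \<in> U (n + m)}"
  using openin_continuous_map_preimage[OF continuous_map_tri[OF domain_closed[OF n X] domain_closed[OF m Y] C]
      open_domain, of ] n by auto

lemma zero_mem_line:
  assumes n: "n \<ge> 1" and m: "m \<ge> 1" and X: "X \<in> U n" and Y: "Y \<in> U m" and C: "C \<in> rect_tuples g n m"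
  shows "tuple_tri X (tuple_smult 0 C) Y \<in> U (n + m)"
  using dsum_mem[OF n m X Y] by (simp add: tuple_smult_zero[OF C])

lemma eventually_on_line:
  assumes n: "n \<ge> 1" and m: "m \<ge> 1" and X: "X \<in> U n" and Y: "Y \<in> U m" and C: "C \<in> rect_tuples g n m"
  shows "\<forall>\<^sub>F t in at 0. tuple_tri X (tuple_smult t C) Y \<in> U (n + m)"
  using eventually_at_in_open'[OF open_line[OF assms], of 0] zero_mem_line[OF assms] by simp

text \<open>The parameters \<open>t\<close> staying in \<open>U\<close> form an open set. By \<open>constant_on_line\<close> they are also those
  staying in the compact set \<open>K\<close>, so they form a closed set too, that is, all of the plane; but a
  complex line in a compact set is constant.\<close>

lemma intertwine_reflect:
  assumes n: "n \<ge> 1" and m: "m \<ge> 1" and X: "X \<in> U n" and Y: "Y \<in> U m"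
    and G: "G \<in> carrier_mat n m"
    and fG: "\<And>k. k < g' \<Longrightarrow> f n X ! k * G = G * f m Y ! k"
    and K: "compactin (nc_top g (n + m)) K" "K \<subseteq> U (n + m)"
    and fiber: "\<And>W. W \<in> U (n + m) \<Longrightarrow>
      f (n + m) W = f (n + m) (tuple_tri X (replicate g (0\<^sub>m n m)) Y) \<Longrightarrow> W \<in> K"
    and k: "k < g"
  shows "X ! k * G = G * Y ! k"
proof -
  define C where "C = map (\<lambda>k. X ! k * G - G * Y ! k) [0..<g]"
  have cXY: "X ! l \<in> carrier_mat n n" "Y ! l \<in> carrier_mat m m" if "l < g" for l
    using domain_closed[OF n X] domain_closed[OF m Y] that by (auto simp: nc_tuples_def)
  have C: "C \<in> rect_tuples g n m"
    unfolding C_def rect_tuples_def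
  proof (intro CollectI conjI allI impI)
    fix l assume l: "l < g"
    have "X ! l * G \<in> carrier_mat n m" "G * Y ! l \<in> carrier_mat n m" using cXY[OF l] G by auto
    then show "map (\<lambda>k. X ! k * G - G * Y ! k) [0..<g] ! l \<in> carrier_mat n m"
      using l by (simp add: minus_carrier_mat)
  qed simp
  let ?T = "\<lambda>t. tuple_tri X (tuple_smult t C) Y"
  note cont = continuous_map_tri[OF domain_closed[OF n X] domain_closed[OF m Y] C]
  have TK: "?T t \<in> K" if "?T t \<in> U (n + m)" for t
    using fiber[OF that] constant_on_line[OF n m X Y G fG C_def that] by simp
  have "closedin (nc_top g (n + m)) K"
    by (rule compactin_imp_closedin[OF Hausdorff_nc_top K(1)])
  from closedin_continuous_map_preimage[OF cont this] have "closed {t. ?T t \<in> K}" by simp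
  moreover have "{t. ?T t \<in> K} = {t. ?T t \<in> U (n + m)}" using TK K(2) by blast
  ultimately have "{t. ?T t \<in> U (n + m)} = UNIV"
    using clopen[of "{t. ?T t \<in> U (n + m)}"] open_line[OF n m X Y C] zero_mem_line[OF n m X Y C] by auto
  then have inK: "?T t \<in> K" for t using TK by auto
  have "C ! k = 0\<^sub>m n m"
  proof (rule eq_matI)
    fix i j assume "i < dim_row (0\<^sub>m n m :: complex mat)" "j < dim_col (0\<^sub>m n m :: complex mat)"
    then have ij: "i < n" "j < m" by auto
    have p: "(k, i, n + j) \<in> entry_index g (n + m)" using k ij by (simp add: entry_index_def)
    have "compactin euclidean ((\<lambda>W. tuple_entry W (k, i, n + j)) ` K)"
      by (rule image_compactin[OF K(1) continuous_map_tuple_entry[OF p]])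
    then have "bounded ((\<lambda>W. tuple_entry W (k, i, n + j)) ` K)" using compact_imp_bounded by simp
    then obtain B where B: "\<And>W. W \<in> K \<Longrightarrow> cmod (tuple_entry W (k, i, n + j)) \<le> B"
      by (auto simp: bounded_iff)
    have e: "tuple_entry (?T t) (k, i, n + j) = t * C ! k $$ (i, j)" for t
      using ij k rect_tuples_nth[OF C k]
      by (subst tuple_entry_tri[OF domain_closed[OF n X] domain_closed[OF m Y] k])
        (auto simp: tuple_smult_nth[OF C k])
    show "C ! k $$ (i, j) = 0\<^sub>m n m $$ (i, j)"
    proof (rule ccontr)
      assume "C ! k $$ (i, j) \<noteq> 0\<^sub>m n m $$ (i, j)"
      then have "C ! k $$ (i, j) \<noteq> 0" using ij by simp
      \<comment> \<open>The parameter \<open>t\<close> is chosen so that the corner entry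
        \<open>t * C ! k $$ (i, j)\<close> equals \<open>\<bar>B\<bar> + 1\<close>, which exceeds
        the bound \<open>B\<close>.\<close>
      then have "cmod (complex_of_real (\<bar>B\<bar> + 1)) \<le> B"
        using B[OF inK, of "complex_of_real (\<bar>B\<bar> + 1) / C ! k $$ (i, j)"] by (simp add: e)
      then show False by (simp del: of_real_add)
    qed
  qed (use rect_tuples_nth[OF C k] in auto)
  then have "X ! k * G - G * Y ! k = 0\<^sub>m n m" using k by (simp add: C_def)
  moreover have "X ! k * G \<in> carrier_mat n m" "G * Y ! k \<in> carrier_mat n m" using cXY[OF k] G by auto
  ultimately show ?thesis by (rule minus_mat_eq_zeroD[rotated -1])
qed

text \<open>The hypothesis covers both of the first two parts of the theorem: for a proper map
  \<open>K\<close> is the fibre itself, and in the second part it is the closure of the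
  fibre.\<close>

lemma inverse_free_map:
  assumes K: "\<And>n X. n \<ge> 1 \<Longrightarrow> X \<in> U n \<Longrightarrow>
    \<exists>K. compactin (nc_top g n) K \<and> {W \<in> U n. f n W = f n X} \<subseteq> K \<and> K \<subseteq> U n"
  shows "one_to_one U f" "free_map g' g (nc_image f U) (nc_inverse f U)"
    "maps_into (nc_image f U) U (nc_inverse f U)"
proof -
  have R: "X ! k * G = G * Y ! k"
    if "n \<ge> 1" "m \<ge> 1" "X \<in> U n" "Y \<in> U m" "G \<in> carrier_mat n m"
      "\<And>k. k < g' \<Longrightarrow> f n X ! k * G = G * f m Y ! k" "k < g" for n m X Y G k
  proof -
    have "n + m \<ge> 1" using that by simp
    \<comment> \<open>The relevant fibre is the one through the direct sum of \<open>X\<close> and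
      \<open>Y\<close>, at size \<open>n + m\<close>; even injectivity at size \<open>n\<close>
      relies on compactness at size \<open>2n\<close>.\<close>
    from K[OF this dsum_mem[OF that(1-4)]] obtain K where
      "compactin (nc_top g (n + m)) K" "K \<subseteq> U (n + m)"
      "\<And>W. W \<in> U (n + m) \<Longrightarrow>
        f (n + m) W = f (n + m) (tuple_tri X (replicate g (0\<^sub>m n m)) Y) \<Longrightarrow> W \<in> K" by auto
    from intertwine_reflect[OF that(1-6) this that(7)] show ?thesis by blast
  qed
  show inj: "one_to_one U f"
    unfolding one_to_one_def
  proof (intro allI impI inj_onI)
    fix n X Y assume n: "n \<ge> 1" and X: "X \<in> U n" and Y: "Y \<in> U n" and e: "f n X = f n Y"
    note cX = domain_closed[OF n X] and cY = domain_closed[OF n Y]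
    show "X = Y"
    proof (rule nth_equalityI)
      fix k assume "k < length X"
      then have k: "k < g" using cX by (simp add: nc_tuples_def)
      have "X ! k * 1\<^sub>m n = 1\<^sub>m n * Y ! k"
      proof (rule R[OF n n X Y _ _ k])
        fix l assume "l < g'"
        then show "f n X ! l * 1\<^sub>m n = 1\<^sub>m n * f n Y ! l"
          unfolding e by (intro one_mat_commute nc_tuples_nth[OF image_closed[OF n Y]])
      qed simp
      then show "X ! k = Y ! k" using nc_tuples_nth[OF cX k] nc_tuples_nth[OF cY k] by simp
    qed (use cX cY in \<open>simp add: nc_tuples_def\<close>)
  qed
  have inv: "nc_inverse f U n (f n X) = X" if "n \<ge> 1" "X \<in> U n" for n X
    using inj that by (simp add: nc_inverse_def one_to_one_def the_inv_into_f_f)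
  show "maps_into (nc_image f U) U (nc_inverse f U)"
    by (auto simp: maps_into_def nc_image_def inv)
  show "free_map g' g (nc_image f U) (nc_inverse f U)"
    unfolding free_map_def nc_image_def
    using R by (auto simp: inv domain_closed)
qed

section \<open>The derivative as a corner\<close>

text \<open>The derivative of \<open>f\<close> at \<open>X\<close> in direction \<open>H\<close> is read off from the corner of \<open>f\<close> at the matrix
  with rows \<open>(X, s H)\<close> and \<open>(0, X)\<close>, for any small \<open>s \<noteq> 0\<close>.\<close>

definition derivative :: "nat \<Rightarrow> complex mat list \<Rightarrow> complex mat list \<Rightarrow> complex mat list" where
  "derivative n X H = (let s = SOME s. s \<noteq> 0 \<and> tuple_tri X (tuple_smult s H) X \<in> U (n + n)
     in tuple_smult (1 / s) (corner n n (f (n + n) (tuple_tri X (tuple_smult s H) X))))"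

text \<open>The admissible \<open>s\<close> form an open set containing 0, and 0 is not isolated in
  the plane, so the choice in \<open>derivative\<close> is not vacuous.\<close>

lemma derivative_scale:
  assumes n: "n \<ge> 1" and X: "X \<in> U n" and H: "H \<in> nc_tuples g n"
  obtains s where "s \<noteq> 0" "tuple_tri X (tuple_smult s H) X \<in> U (n + n)"
    "derivative n X H = tuple_smult (1 / s) (corner n n (f (n + n) (tuple_tri X (tuple_smult s H) X)))"
proof -
  define s where "s = (SOME s. s \<noteq> 0 \<and> tuple_tri X (tuple_smult s H) X \<in> U (n + n))"
  have "\<forall>\<^sub>F t in at 0. t \<noteq> 0 \<and> tuple_tri X (tuple_smult t H) X \<in> U (n + n)"
    using eventually_on_line[OF n n X X, of H] H eventually_neq_at_within[of 0 0 UNIV]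
    by (auto simp: nc_tuples_rect intro: eventually_conj)
  then have "\<exists>t. t \<noteq> 0 \<and> tuple_tri X (tuple_smult t H) X \<in> U (n + n)"
    by (rule eventually_happens'[rotated]) simp
  then have "s \<noteq> 0 \<and> tuple_tri X (tuple_smult s H) X \<in> U (n + n)"
    unfolding s_def by (rule someI_ex)
  then show ?thesis using that[of s] by (simp add: derivative_def s_def[symmetric] Let_def)
qed

lemma corner_image_closed:
  assumes "n \<ge> 1" "m \<ge> 1" "T \<in> U (n + m)"
  shows "corner n m (f (n + m) T) \<in> rect_tuples g' n m"
  using image_closed[of "n + m" T] assms by (intro corner_closed) (auto simp: nc_tuples_def)

text \<open>Intertwining with the scalar blocks \<open>G1 = a\<close>, \<open>G2 = 0\<close>,
  \<open>G3 = b\<close>. It gives both the independence of \<open>derivative\<close> from the chosen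
  scale and its homogeneity.\<close>

lemma corner_homogeneous:
  assumes n: "n \<ge> 1" and X: "X \<in> U n"
    and C: "C \<in> nc_tuples g n" "tuple_tri X C X \<in> U (n + n)"
    and C': "C' \<in> nc_tuples g n" "tuple_tri X C' X \<in> U (n + n)"
    and e: "\<And>k. k < g \<Longrightarrow> b \<cdot>\<^sub>m C ! k = a \<cdot>\<^sub>m C' ! k" and k: "k < g'"
  shows "b \<cdot>\<^sub>m corner n n (f (n + n) (tuple_tri X C X)) ! k = a \<cdot>\<^sub>m corner n n (f (n + n) (tuple_tri X C' X)) ! k"
proof -
  let ?A = "corner n n (f (n + n) (tuple_tri X C X)) ! k"
  let ?B = "corner n n (f (n + n) (tuple_tri X C' X)) ! k"
  have c: "?A \<in> carrier_mat n n" "?B \<in> carrier_mat n n" "f n X ! k \<in> carrier_mat n n"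
    using rect_tuples_nth[OF corner_image_closed[OF n n C(2)] k]
      rect_tuples_nth[OF corner_image_closed[OF n n C'(2)] k]
      nc_tuples_nth[OF image_closed[OF n X] k] .
  have sm: "A * (x \<cdot>\<^sub>m 1\<^sub>m n) = x \<cdot>\<^sub>m A" "(x \<cdot>\<^sub>m 1\<^sub>m n) * A = x \<cdot>\<^sub>m A"
    if "A \<in> carrier_mat n n" for A :: "complex mat" and x
    using that mult_smult_distrib[OF that one_carrier_mat, of x] smult_one_mat_commute[OF that, of x] by auto
  have "f n X ! k * 0\<^sub>m n n + ?A * (b \<cdot>\<^sub>m 1\<^sub>m n) = (a \<cdot>\<^sub>m 1\<^sub>m n) * ?B + 0\<^sub>m n n * f n X ! k"
  proof (rule tri_intertwine[OF n n n n X X X X C(1)[unfolded nc_tuples_rect] C'(1)[unfolded nc_tuples_rect] C(2) C'(2) _ _ _ _ _ _ k])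
    fix l assume l: "l < g"
    note cl = nc_tuples_nth[OF domain_closed[OF n X] l] nc_tuples_nth[OF C(1) l] nc_tuples_nth[OF C'(1) l]
    show "X ! l * (a \<cdot>\<^sub>m 1\<^sub>m n) = a \<cdot>\<^sub>m 1\<^sub>m n * X ! l" by (rule smult_one_mat_commute[OF cl(1)])
    show "X ! l * (b \<cdot>\<^sub>m 1\<^sub>m n) = b \<cdot>\<^sub>m 1\<^sub>m n * X ! l" by (rule smult_one_mat_commute[OF cl(1)])
    show "X ! l * 0\<^sub>m n n + C ! l * (b \<cdot>\<^sub>m 1\<^sub>m n) = a \<cdot>\<^sub>m 1\<^sub>m n * C' ! l + 0\<^sub>m n n * X ! l"
      using cl e[OF l] by (simp add: sm)
  qed auto
  then show ?thesis using c by (simp add: sm)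
qed

lemma derivative_closed:
  assumes n: "n \<ge> 1" and X: "X \<in> U n" and H: "H \<in> nc_tuples g n"
  shows "derivative n X H \<in> nc_tuples g' n"
proof -
  obtain s where s: "s \<noteq> 0" "tuple_tri X (tuple_smult s H) X \<in> U (n + n)"
    "derivative n X H = tuple_smult (1 / s) (corner n n (f (n + n) (tuple_tri X (tuple_smult s H) X)))"
    by (rule derivative_scale[OF assms])
  show ?thesis
    unfolding s(3) nc_tuples_rect by (intro tuple_smult_rect corner_image_closed n s(2))
qed

text \<open>With \<open>s\<close> the scale chosen in \<open>derivative\<close>, the corners
  \<open>t H\<close> and \<open>s H\<close> satisfy \<open>s (t H) = t (s H)\<close>, so their
  images are in the same proportion. Division is by \<open>s\<close> only, hence
  \<open>t = 0\<close> is allowed.\<close>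

lemma corner_eq_derivative:
  assumes n: "n \<ge> 1" and X: "X \<in> U n" and H: "H \<in> nc_tuples g n"
    and T: "tuple_tri X (tuple_smult t H) X \<in> U (n + n)" and k: "k < g'"
  shows "corner n n (f (n + n) (tuple_tri X (tuple_smult t H) X)) ! k = t \<cdot>\<^sub>m derivative n X H ! k"
proof -
  obtain s where s: "s \<noteq> 0" "tuple_tri X (tuple_smult s H) X \<in> U (n + n)"
    and L: "derivative n X H = tuple_smult (1 / s) (corner n n (f (n + n) (tuple_tri X (tuple_smult s H) X)))"
    by (rule derivative_scale[OF n X H])
  let ?A = "corner n n (f (n + n) (tuple_tri X (tuple_smult t H) X)) ! k"
  let ?B = "corner n n (f (n + n) (tuple_tri X (tuple_smult s H) X)) ! k"
  have Hr: "H \<in> rect_tuples g n n" using H by (simp add: nc_tuples_rect)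
  have c: "?A \<in> carrier_mat n n" "?B \<in> carrier_mat n n"
    using rect_tuples_nth[OF corner_image_closed[OF n n T] k]
      rect_tuples_nth[OF corner_image_closed[OF n n s(2)] k] .
  have eq: "s \<cdot>\<^sub>m ?A = t \<cdot>\<^sub>m ?B"
    by (rule corner_homogeneous[OF n X _ T _ s(2) _ k])
      (auto simp: nc_tuples_rect tuple_smult_rect[OF Hr] tuple_smult_nth[OF Hr] intro: smult_smult_mat_commute)
  have e: "s * ?A $$ (i, j) = t * ?B $$ (i, j)" if "i < n" "j < n" for i j
    using c that arg_cong[OF eq, of "\<lambda>M. M $$ (i, j)"] by auto
  have "?A = t \<cdot>\<^sub>m ((1 / s) \<cdot>\<^sub>m ?B)"
    using c e s(1) by (intro eq_matI) (auto simp: field_simps)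
  then show ?thesis
    unfolding L tuple_smult_nth[OF corner_image_closed[OF n n s(2)] k] .
qed

text \<open>Take the corner of \<open>f\<close> at the matrix with rows \<open>(X, (s H, s K))\<close> and \<open>(0, X \<oplus> X)\<close>. Multiplying it by
  the block columns \<open>(1, 0)\<close>, \<open>(0, 1)\<close> and \<open>(1, 1)\<close> gives the corners for \<open>s H\<close>, \<open>s K\<close> and \<open>s (H + K)\<close>.\<close>

lemma derivative_add:
  assumes n: "n \<ge> 1" and X: "X \<in> U n" and H: "H \<in> nc_tuples g n" and K: "K \<in> nc_tuples g n"
  shows "derivative n X (tuple_add H K) = tuple_add (derivative n X H) (derivative n X K)"
proof -
  let ?XX = "tuple_tri X (replicate g (0\<^sub>m n n)) X"
  let ?B = "map (\<lambda>k. append_cols_mat (H ! k) (K ! k)) [0..<g]"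
  let ?S = "tuple_add H K"
  have nn: "n + n \<ge> 1" using n by simp
  have XX: "?XX \<in> U (n + n)" by (rule dsum_mem[OF n n X X])
  have S: "?S \<in> nc_tuples g n" using H K by (auto simp: tuple_add_def nc_tuples_def)
  have Snth: "?S ! k = H ! k + K ! k" if "k < g" for k
    using that H K by (auto simp: tuple_add_def nc_tuples_def)
  have B: "?B \<in> rect_tuples g n (n + n)"
    using append_cols_mat_carrier nc_tuples_nth[OF H] nc_tuples_nth[OF K] by (simp add: rect_tuples_def)
  note Hr = H[unfolded nc_tuples_rect] and Kr = K[unfolded nc_tuples_rect] and Sr = S[unfolded nc_tuples_rect]
  \<comment> \<open>A single \<open>t\<close> has to serve all four triangular tuples, so that their
    corners can be compared.\<close>
  have "\<forall>\<^sub>F t in at 0. t \<noteq> 0 \<and> tuple_tri X (tuple_smult t H) X \<in> U (n + n) \<and>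
      tuple_tri X (tuple_smult t K) X \<in> U (n + n) \<and> tuple_tri X (tuple_smult t ?S) X \<in> U (n + n) \<and>
      tuple_tri X (tuple_smult t ?B) ?XX \<in> U (n + (n + n))"
    by (intro eventually_conj eventually_on_line eventually_neq_at_within n nn X XX Hr Kr Sr B)
  then have "\<exists>t. t \<noteq> 0 \<and> tuple_tri X (tuple_smult t H) X \<in> U (n + n) \<and>
      tuple_tri X (tuple_smult t K) X \<in> U (n + n) \<and> tuple_tri X (tuple_smult t ?S) X \<in> U (n + n) \<and>
      tuple_tri X (tuple_smult t ?B) ?XX \<in> U (n + (n + n))"
    by (rule eventually_happens'[rotated]) simp
  then obtain t where t0: "t \<noteq> 0" and tH: "tuple_tri X (tuple_smult t H) X \<in> U (n + n)"
    and tK: "tuple_tri X (tuple_smult t K) X \<in> U (n + n)" and tS: "tuple_tri X (tuple_smult t ?S) X \<in> U (n + n)"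
    and tB: "tuple_tri X (tuple_smult t ?B) ?XX \<in> U (n + (n + n))" by blast
  let ?D = "corner n (n + n) (f (n + (n + n)) (tuple_tri X (tuple_smult t ?B) ?XX))"
  note LH = derivative_closed[OF n X H] and LK = derivative_closed[OF n X K] and LS = derivative_closed[OF n X S]
  show ?thesis
  proof (rule nth_equalityI)
    show "length (derivative n X ?S) = length (tuple_add (derivative n X H) (derivative n X K))"
      using LH LK LS by (simp add: tuple_add_def nc_tuples_def)
    fix k assume "k < length (derivative n X ?S)"
    then have k: "k < g'" using LS by (simp add: nc_tuples_def)
    have D: "?D ! k \<in> carrier_mat n (n + n)"
      by (rule rect_tuples_nth[OF corner_image_closed[OF n nn tB] k])
    note cL = nc_tuples_nth[OF LH k] nc_tuples_nth[OF LK k] nc_tuples_nth[OF LS k]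
    \<comment> \<open>The three block columns are treated at once: \<open>?J\<close> with entries
      \<open>a\<close> and \<open>b\<close> picks out of the corner \<open>(H, K)\<close> the
      combination \<open>a H + b K\<close>.\<close>
    have main: "?D ! k * (a \<cdot>\<^sub>m 1\<^sub>m n @\<^sub>r b \<cdot>\<^sub>m 1\<^sub>m n) = t \<cdot>\<^sub>m derivative n X C ! k"
      if C: "C \<in> nc_tuples g n" and tC: "tuple_tri X (tuple_smult t C) X \<in> U (n + n)"
        and CB: "\<And>l. l < g \<Longrightarrow> C ! l = a \<cdot>\<^sub>m H ! l + b \<cdot>\<^sub>m K ! l" for a b C
    proof -
      let ?J = "a \<cdot>\<^sub>m 1\<^sub>m n @\<^sub>r b \<cdot>\<^sub>m 1\<^sub>m n :: complex mat"
      have J: "?J \<in> carrier_mat (n + n) n" by (rule carrier_append_rows) auto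
      note Cr = C[unfolded nc_tuples_rect]
      let ?E = "corner n n (f (n + n) (tuple_tri X (tuple_smult t C) X)) ! k"
      have cE: "?E \<in> carrier_mat n n" by (rule rect_tuples_nth[OF corner_image_closed[OF n n tC] k])
      have "f n X ! k * 0\<^sub>m n n + ?D ! k * ?J = 1\<^sub>m n * ?E + 0\<^sub>m n n * f n X ! k"
      proof (rule tri_intertwine[OF n nn n n X XX X X tuple_smult_rect[OF B] tuple_smult_rect[OF Cr] tB tC
            one_carrier_mat zero_carrier_mat J _ _ _ k])
        fix l assume l: "l < g"
        note c = nc_tuples_nth[OF domain_closed[OF n X] l] nc_tuples_nth[OF H l] nc_tuples_nth[OF K l]
        note tri = tuple_tri_nth[OF domain_closed[OF n X] domain_closed[OF n X] l]
        show "X ! l * 1\<^sub>m n = 1\<^sub>m n * X ! l" by (rule one_mat_commute[OF c(1)])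
        have m1: "X ! l * (a \<cdot>\<^sub>m 1\<^sub>m n) + 0\<^sub>m n n * (b \<cdot>\<^sub>m 1\<^sub>m n) = a \<cdot>\<^sub>m X ! l" for a b
          using c(1) by (simp add: mult_smult_distrib[OF c(1) one_carrier_mat])
        have m2: "0\<^sub>m n n * (a \<cdot>\<^sub>m 1\<^sub>m n) + X ! l * (b \<cdot>\<^sub>m 1\<^sub>m n) = b \<cdot>\<^sub>m X ! l" for a b
          using c(1) by (simp add: mult_smult_distrib[OF c(1) one_carrier_mat])
        have m3: "(a \<cdot>\<^sub>m 1\<^sub>m n) * X ! l = a \<cdot>\<^sub>m X ! l" for a
          using c(1) by (simp add: mult_smult_assoc_mat[OF one_carrier_mat c(1)])
        show "?XX ! l * ?J = ?J * X ! l"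
          unfolding tri using c(1) l
          by (simp add: four_block_mat_mult_append_rows[of _ n n _ n _ n _ _ n]
              append_rows_mult[of _ n n _ n _ n] m1 m2 m3
              mult_smult_distrib[OF c(1) one_carrier_mat])
        have "tuple_smult t ?B ! l * ?J = t \<cdot>\<^sub>m (append_cols_mat (H ! l) (K ! l) * ?J)"
          using l mult_smult_assoc_mat[OF append_cols_mat_carrier[OF c(2,3)] J]
          by (simp add: tuple_smult_nth[OF B l])
        also have "append_cols_mat (H ! l) (K ! l) * ?J = C ! l"
          using c by (simp add: append_cols_mat_mult_append_rows[of _ n n _ n _ n] CB[OF l]
              mult_smult_distrib[OF c(2) one_carrier_mat] mult_smult_distrib[OF c(3) one_carrier_mat])
        finally show "X ! l * 0\<^sub>m n n + tuple_smult t ?B ! l * ?J = 1\<^sub>m n * tuple_smult t C ! l + 0\<^sub>m n n * X ! l"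
          using c nc_tuples_nth[OF C l] by (simp add: tuple_smult_nth[OF Cr l])
      qed
      moreover have "?D ! k * ?J \<in> carrier_mat n n" using D J by (rule mult_carrier_mat)
      ultimately have "?D ! k * ?J = ?E"
        using cE nc_tuples_nth[OF image_closed[OF n X] k] by simp
      then show ?thesis using corner_eq_derivative[OF n X C tC k] by simp
    qed
    have e: "?D ! k * (1 \<cdot>\<^sub>m 1\<^sub>m n @\<^sub>r 0 \<cdot>\<^sub>m 1\<^sub>m n) = t \<cdot>\<^sub>m derivative n X H ! k"
      "?D ! k * (0 \<cdot>\<^sub>m 1\<^sub>m n @\<^sub>r 1 \<cdot>\<^sub>m 1\<^sub>m n) = t \<cdot>\<^sub>m derivative n X K ! k"
      "?D ! k * (1 \<cdot>\<^sub>m 1\<^sub>m n @\<^sub>r 1 \<cdot>\<^sub>m 1\<^sub>m n) = t \<cdot>\<^sub>m derivative n X ?S ! k"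
    proof -
      have c: "H ! l = 1 \<cdot>\<^sub>m H ! l + 0 \<cdot>\<^sub>m K ! l" "K ! l = 0 \<cdot>\<^sub>m H ! l + 1 \<cdot>\<^sub>m K ! l"
        "?S ! l = 1 \<cdot>\<^sub>m H ! l + 1 \<cdot>\<^sub>m K ! l" if "l < g" for l
        using nc_tuples_nth[OF H that] nc_tuples_nth[OF K that]
        by (auto intro!: eq_matI simp: Snth[OF that])
      show "?D ! k * (1 \<cdot>\<^sub>m 1\<^sub>m n @\<^sub>r 0 \<cdot>\<^sub>m 1\<^sub>m n) = t \<cdot>\<^sub>m derivative n X H ! k"
        by (rule main[OF H tH c(1)])
      show "?D ! k * (0 \<cdot>\<^sub>m 1\<^sub>m n @\<^sub>r 1 \<cdot>\<^sub>m 1\<^sub>m n) = t \<cdot>\<^sub>m derivative n X K ! k"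
        by (rule main[OF K tK c(2)])
      show "?D ! k * (1 \<cdot>\<^sub>m 1\<^sub>m n @\<^sub>r 1 \<cdot>\<^sub>m 1\<^sub>m n) = t \<cdot>\<^sub>m derivative n X ?S ! k"
        by (rule main[OF S tS c(3)])
    qed
    have J: "(a \<cdot>\<^sub>m 1\<^sub>m n @\<^sub>r b \<cdot>\<^sub>m 1\<^sub>m n :: complex mat) \<in> carrier_mat (n + n) n" for a b
      by (rule carrier_append_rows) auto
    \<comment> \<open>Additivity of the derivative is now distributivity: the column
      \<open>(1, 1)\<close> is the sum of \<open>(1, 0)\<close> and \<open>(0, 1)\<close>, all
      multiplied by the same \<open>?D\<close>.\<close>
    have J_add: "(1 \<cdot>\<^sub>m 1\<^sub>m n @\<^sub>r 1 \<cdot>\<^sub>m 1\<^sub>m n :: complex mat)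
        = (1 \<cdot>\<^sub>m 1\<^sub>m n @\<^sub>r 0 \<cdot>\<^sub>m 1\<^sub>m n) + (0 \<cdot>\<^sub>m 1\<^sub>m n @\<^sub>r 1 \<cdot>\<^sub>m 1\<^sub>m n)"
      by (rule eq_matI) (auto simp: append_rows_def)
    have eq: "t \<cdot>\<^sub>m derivative n X ?S ! k = t \<cdot>\<^sub>m derivative n X H ! k + t \<cdot>\<^sub>m derivative n X K ! k"
      unfolding e[symmetric] J_add by (rule mult_add_distrib_mat[OF D J J])
    have e: "t * derivative n X ?S ! k $$ (i, j) = t * derivative n X H ! k $$ (i, j) + t * derivative n X K ! k $$ (i, j)"
      if "i < n" "j < n" for i j
      using cL that arg_cong[OF eq, of "\<lambda>M. M $$ (i, j)"] by auto
    have "derivative n X ?S ! k = derivative n X H ! k + derivative n X K ! k"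
    proof (rule eq_matI)
      fix i j assume "i < dim_row (derivative n X H ! k + derivative n X K ! k)"
        "j < dim_col (derivative n X H ! k + derivative n X K ! k)"
      then have ij: "i < n" "j < n" using cL by auto
      then have "t * derivative n X ?S ! k $$ (i, j) = t * (derivative n X H ! k $$ (i, j) + derivative n X K ! k $$ (i, j))"
        using e by (simp add: distrib_left)
      then show "derivative n X ?S ! k $$ (i, j) = (derivative n X H ! k + derivative n X K ! k) $$ (i, j)"
        using t0 cL ij by auto
    qed (use cL in auto)
    then show "derivative n X ?S ! k = tuple_add (derivative n X H) (derivative n X K) ! k"
      using k LH LK by (simp add: tuple_add_def nc_tuples_def)
  qed
qed

lemma derivative_smult:
  assumes n: "n \<ge> 1" and X: "X \<in> U n" and H: "H \<in> nc_tuples g n"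
  shows "derivative n X (tuple_smult c H) = tuple_smult c (derivative n X H)"
proof -
  note Hr = H[unfolded nc_tuples_rect]
  note cHr = tuple_smult_rect[OF Hr, of c]
  have cH: "tuple_smult c H \<in> nc_tuples g n" using cHr by (simp add: nc_tuples_rect)
  have "\<forall>\<^sub>F t in at 0. t \<noteq> 0 \<and> tuple_tri X (tuple_smult t H) X \<in> U (n + n) \<and>
      tuple_tri X (tuple_smult t (tuple_smult c H)) X \<in> U (n + n)"
    by (intro eventually_conj eventually_on_line eventually_neq_at_within n X Hr cHr)
  then have "\<exists>t. t \<noteq> 0 \<and> tuple_tri X (tuple_smult t H) X \<in> U (n + n) \<and>
      tuple_tri X (tuple_smult t (tuple_smult c H)) X \<in> U (n + n)"
    by (rule eventually_happens'[rotated]) simp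
  then obtain t where t0: "t \<noteq> 0" and tH: "tuple_tri X (tuple_smult t H) X \<in> U (n + n)"
    and tcH: "tuple_tri X (tuple_smult t (tuple_smult c H)) X \<in> U (n + n)" by blast
  note LH = derivative_closed[OF n X H] and LcH = derivative_closed[OF n X cH]
  show ?thesis
  proof (rule nth_equalityI)
    show "length (derivative n X (tuple_smult c H)) = length (tuple_smult c (derivative n X H))"
      using LH LcH by (simp add: tuple_smult_def nc_tuples_def)
    fix k assume "k < length (derivative n X (tuple_smult c H))"
    then have k: "k < g'" using LcH by (simp add: nc_tuples_def)
    note cL = nc_tuples_nth[OF LH k] nc_tuples_nth[OF LcH k]
    \<comment> \<open>The two corners are \<open>t (c H)\<close> and \<open>t H\<close>, hence the
      weights 1 and \<open>c\<close>.\<close>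
    have "1 \<cdot>\<^sub>m corner n n (f (n + n) (tuple_tri X (tuple_smult t (tuple_smult c H)) X)) ! k
        = c \<cdot>\<^sub>m corner n n (f (n + n) (tuple_tri X (tuple_smult t H) X)) ! k"
      by (rule corner_homogeneous[OF n X _ tcH _ tH _ k])
        (auto simp: nc_tuples_rect tuple_smult_rect[OF Hr] tuple_smult_rect[OF cHr]
          tuple_smult_nth[OF Hr] tuple_smult_nth[OF cHr] smult_smult_mat_commute intro!: eq_matI)
    then have "t \<cdot>\<^sub>m derivative n X (tuple_smult c H) ! k = c \<cdot>\<^sub>m (t \<cdot>\<^sub>m derivative n X H ! k)"
      unfolding corner_eq_derivative[OF n X cH tcH k] corner_eq_derivative[OF n X H tH k]
      by (simp add: one_smult_mat)
    then have e: "(t \<cdot>\<^sub>m derivative n X (tuple_smult c H) ! k) $$ (i, j) = (c \<cdot>\<^sub>m (t \<cdot>\<^sub>m derivative n X H ! k)) $$ (i, j)" for i j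
      by simp
    have "derivative n X (tuple_smult c H) ! k = c \<cdot>\<^sub>m derivative n X H ! k"
    proof (rule eq_matI)
      fix i j assume "i < dim_row (c \<cdot>\<^sub>m derivative n X H ! k)" "j < dim_col (c \<cdot>\<^sub>m derivative n X H ! k)"
      then show "derivative n X (tuple_smult c H) ! k $$ (i, j) = (c \<cdot>\<^sub>m derivative n X H ! k) $$ (i, j)"
        using cL e[of i j] t0 by auto
    qed (use cL in auto)
    then show "derivative n X (tuple_smult c H) ! k = tuple_smult c (derivative n X H) ! k"
      using k LH by (simp add: tuple_smult_def nc_tuples_def)
  qed
qed

lemma tuple_clinear_derivative:
  assumes "n \<ge> 1" "X \<in> U n"
  shows "tuple_clinear g g' n (derivative n X)"
  using derivative_closed[OF assms] derivative_add[OF assms] derivative_smult[OF assms]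
  by (simp add: tuple_clinear_def)

section \<open>The linearisation error and holomorphy\<close>

text \<open>With \<open>Y = X + H\<close> and \<open>P\<close> the matrix with rows \<open>(X, b H)\<close> and \<open>(0, X)\<close>, the matrix \<open>P \<oplus> Y\<close> is
  similar to a perturbation \<open>Z\<close> of \<open>X \<oplus> X \<oplus> X\<close>, through the block column with entries \<open>b\<^sup>2\<close> and \<open>b\<close>.
  The corner of \<open>f Z\<close> then contains \<open>b\<^sup>2\<close> times the linearisation error.\<close>

lemma linearisation_error_entry:
  fixes b :: complex
  assumes n: "n \<ge> 1" and X: "X \<in> U n" and Y: "Y \<in> U n"
    and H: "H = tuple_sub Y X" and P: "P = tuple_tri X (tuple_smult b H) X"
    and C: "C = map (\<lambda>k. 0\<^sub>m n n @\<^sub>r (- b) \<cdot>\<^sub>m H ! k) [0..<g]"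
    and PU: "P \<in> U (n + n)" and ZU: "tuple_tri P C Y \<in> U (n + n + n)"
    and kij: "k < g'" "i < n" "j < n"
  shows "f (n + n + n) (tuple_tri P C Y) ! k $$ (i, n + n + j)
    = b\<^sup>2 * (f n X ! k $$ (i, j) + derivative n X H ! k $$ (i, j) - f n Y ! k $$ (i, j))"
proof -
  have nn: "n + n \<ge> 1" using n by simp
  note cX = domain_closed[OF n X] and cY = domain_closed[OF n Y]
  have cH: "H \<in> nc_tuples g n" unfolding H by (rule tuple_sub_closed[OF cY cX])
  note Hr = cH[unfolded nc_tuples_rect]
  have Hnth: "H ! l = Y ! l - X ! l" if "l < g" for l
    unfolding H using cX cY that by (simp add: tuple_sub_nth nc_tuples_def)
  let ?O = "replicate g (0\<^sub>m (n + n) n) :: complex mat list"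
  have O: "?O \<in> rect_tuples g (n + n) n" by (simp add: rect_tuples_def)
  have OU: "tuple_tri P ?O Y \<in> U (n + n + n)" by (rule dsum_mem[OF nn n PU Y])
  have Cl: "C ! l \<in> carrier_mat (n + n) n" if "l < g" for l
    using that nc_tuples_nth[OF cH that] unfolding C by (simp add: carrier_append_rows)
  have Cr: "C \<in> rect_tuples g (n + n) n"
    using Cl by (simp add: rect_tuples_def) (simp add: C)
  \<comment> \<open>The corner needed for the similarity is \<open>C = P G - G Y\<close>. With
    entries \<open>b\<^sup>2\<close> and \<open>b\<close> in \<open>?G\<close>, its upper half is
    \<open>b\<^sup>2 (X + H - Y) = 0\<close> and its lower half is \<open>b (X - Y) = - b H\<close>.
    So \<open>C\<close> is only of size \<open>b H\<close>, although the error gets multiplied by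
    \<open>b\<^sup>2\<close>.\<close>
  let ?G = "b\<^sup>2 \<cdot>\<^sub>m 1\<^sub>m n @\<^sub>r b \<cdot>\<^sub>m 1\<^sub>m n :: complex mat"
  have G: "?G \<in> carrier_mat (n + n) n" by (rule carrier_append_rows) auto
  let ?D = "corner (n + n) n (f (n + n + n) (tuple_tri P C Y)) ! k"
  have prod: "four_block_mat A (b \<cdot>\<^sub>m B) (0\<^sub>m n n) A * ?G = (b\<^sup>2 \<cdot>\<^sub>m (A + B)) @\<^sub>r (b \<cdot>\<^sub>m A)"
    and prod': "?G * A = (b\<^sup>2 \<cdot>\<^sub>m A) @\<^sub>r (b \<cdot>\<^sub>m A)"
    if A: "A \<in> carrier_mat n n" and B: "B \<in> carrier_mat n n" for A B :: "complex mat"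
  proof -
    have bB: "b \<cdot>\<^sub>m B \<in> carrier_mat n n" using B by simp
    have "b \<cdot>\<^sub>m (b \<cdot>\<^sub>m B) = b\<^sup>2 \<cdot>\<^sub>m B" by (auto intro!: eq_matI simp: power2_eq_square)
    moreover have "b\<^sup>2 \<cdot>\<^sub>m A + b\<^sup>2 \<cdot>\<^sub>m B = b\<^sup>2 \<cdot>\<^sub>m (A + B)"
      using A B by (auto intro!: eq_matI simp: distrib_left)
    moreover have "0\<^sub>m n n * (b\<^sup>2 \<cdot>\<^sub>m 1\<^sub>m n) + A * (b \<cdot>\<^sub>m 1\<^sub>m n) = b \<cdot>\<^sub>m A"
      using A by (simp add: mult_smult_distrib[OF A one_carrier_mat])
    ultimately show "four_block_mat A (b \<cdot>\<^sub>m B) (0\<^sub>m n n) A * ?G = (b\<^sup>2 \<cdot>\<^sub>m (A + B)) @\<^sub>r (b \<cdot>\<^sub>m A)"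
      using A bB
      by (subst four_block_mat_mult_append_rows[of _ n n _ n _ n _ _ n])
        (auto simp: mult_smult_distrib[OF A one_carrier_mat] mult_smult_distrib[OF bB one_carrier_mat])
    show "?G * A = (b\<^sup>2 \<cdot>\<^sub>m A) @\<^sub>r (b \<cdot>\<^sub>m A)"
      by (subst append_rows_mult[of _ n n _ n _ n])
        (use A in \<open>auto simp: mult_smult_assoc_mat[OF one_carrier_mat A]\<close>)
  qed
  have rows_add: "(A @\<^sub>r B) + (A' @\<^sub>r B') = (A + A') @\<^sub>r (B + B')"
    if "A \<in> carrier_mat n n" "B \<in> carrier_mat n n" "A' \<in> carrier_mat n n" "B' \<in> carrier_mat n n"
    for A B A' B' :: "complex mat"
    using that by (intro eq_matI) (auto simp: append_rows_def)
  have "f (n + n) P ! k * ?G + corner (n + n) n (f (n + n + n) (tuple_tri P ?O Y)) ! k * 1\<^sub>m n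
      = 1\<^sub>m (n + n) * ?D + ?G * f n Y ! k"
  proof (rule tri_intertwine[OF nn n nn n PU Y PU Y O Cr OU ZU one_carrier_mat G one_carrier_mat _ _ _ kij(1)])
    fix l assume l: "l < g"
    note c = nc_tuples_nth[OF cX l] nc_tuples_nth[OF cY l] nc_tuples_nth[OF cH l]
    show "P ! l * 1\<^sub>m (n + n) = 1\<^sub>m (n + n) * P ! l"
      by (rule one_mat_commute[OF nc_tuples_nth[OF domain_closed[OF nn PU] l]])
    show "Y ! l * 1\<^sub>m n = 1\<^sub>m n * Y ! l" by (rule one_mat_commute[OF c(2)])
    have "P ! l * ?G = (b\<^sup>2 \<cdot>\<^sub>m (X ! l + H ! l)) @\<^sub>r (b \<cdot>\<^sub>m X ! l)"
      unfolding P tuple_tri_nth[OF cX cX l] tuple_smult_nth[OF Hr l] by (rule prod[OF c(1,3)])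
    also have "X ! l + H ! l = Y ! l" unfolding Hnth[OF l] using c by (intro eq_matI) auto
    finally have 1: "P ! l * ?G = (b\<^sup>2 \<cdot>\<^sub>m Y ! l) @\<^sub>r (b \<cdot>\<^sub>m X ! l)" .
    have "C ! l + ?G * Y ! l = (0\<^sub>m n n + b\<^sup>2 \<cdot>\<^sub>m Y ! l) @\<^sub>r ((- b) \<cdot>\<^sub>m H ! l + b \<cdot>\<^sub>m Y ! l)"
      unfolding prod'[OF c(2,2)] using l c by (simp add: C rows_add)
    also have "0\<^sub>m n n + b\<^sup>2 \<cdot>\<^sub>m Y ! l = b\<^sup>2 \<cdot>\<^sub>m Y ! l" using c by simp
    also have "(- b) \<cdot>\<^sub>m H ! l + b \<cdot>\<^sub>m Y ! l = b \<cdot>\<^sub>m X ! l"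
      unfolding Hnth[OF l] using c by (intro eq_matI) (auto simp: algebra_simps)
    finally have 2: "C ! l + ?G * Y ! l = (b\<^sup>2 \<cdot>\<^sub>m Y ! l) @\<^sub>r (b \<cdot>\<^sub>m X ! l)" .
    have "P ! l * ?G \<in> carrier_mat (n + n) n"
      by (rule mult_carrier_mat[OF nc_tuples_nth[OF domain_closed[OF nn PU] l] G])
    then show "P ! l * ?G + ?O ! l * 1\<^sub>m n = 1\<^sub>m (n + n) * C ! l + ?G * Y ! l"
      using l Cl[OF l] 1 2 by simp
  qed
  then have e: "f (n + n) P ! k * ?G + 0\<^sub>m (n + n) n = ?D + ?G * f n Y ! k"
    using corner_dsum[OF nn n PU Y kij(1)] rect_tuples_nth[OF corner_image_closed[OF nn n ZU] kij(1)] by simp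
  note c = nc_tuples_nth[OF image_closed[OF n X] kij(1)] nc_tuples_nth[OF image_closed[OF n Y] kij(1)]
    nc_tuples_nth[OF derivative_closed[OF n X cH] kij(1)]
  \<comment> \<open>\<open>P\<close> is itself triangular with corner \<open>b H\<close>; this is
    how the derivative enters the identity.\<close>
  have lP: "f (n + n) P = tuple_tri (f n X) (corner n n (f (n + n) P)) (f n X)"
    using tri_image[OF n n X X tuple_smult_rect[OF Hr], of b] PU by (simp add: P)
  have "f (n + n) P ! k = four_block_mat (f n X ! k) (b \<cdot>\<^sub>m derivative n X H ! k) (0\<^sub>m n n) (f n X ! k)"
    using tuple_tri_nth[OF image_closed[OF n X] image_closed[OF n X] kij(1), of "corner n n (f (n + n) P)"]
      corner_eq_derivative[OF n X cH PU[unfolded P] kij(1)] lP by (simp add: P)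
  then have "((b\<^sup>2 \<cdot>\<^sub>m (f n X ! k + derivative n X H ! k)) @\<^sub>r (b \<cdot>\<^sub>m f n X ! k)) + 0\<^sub>m (n + n) n
      = ?D + ((b\<^sup>2 \<cdot>\<^sub>m f n Y ! k) @\<^sub>r (b \<cdot>\<^sub>m f n Y ! k))"
    using e prod[OF c(1,3)] prod'[OF c(2,2)] by simp
  \<comment> \<open>Only the upper half of the block column is read off, since \<open>i < n\<close>;
    the lower half contains just the first difference of \<open>f\<close>.\<close>
  from arg_cong[OF this, of "\<lambda>M. M $$ (i, j)"]
  have "b\<^sup>2 * (f n X ! k $$ (i, j) + derivative n X H ! k $$ (i, j)) = ?D $$ (i, j) + b\<^sup>2 * f n Y ! k $$ (i, j)"
    using c kij rect_tuples_nth[OF corner_image_closed[OF nn n ZU] kij(1)] by (simp add: append_rows_def)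
  moreover have "?D $$ (i, j) = f (n + n + n) (tuple_tri P C Y) ! k $$ (i, n + n + j)"
    using kij image_closed[of "n + n + n", OF _ ZU] n by (subst corner_nth) (auto simp: nc_tuples_def)
  ultimately show ?thesis by (simp add: algebra_simps)
qed

end

lemma openin_nc_topD:
  assumes "openin (nc_top g n) S" "X \<in> S"
  obtains d where "d > 0" "\<And>Y. Y \<in> nc_tuples g n \<Longrightarrow> tuple_dist g n Y X < d \<Longrightarrow> Y \<in> S"
  using assms unfolding openin_nc_top by blast

lemma tuple_entry_smult:
  assumes "A \<in> nc_tuples g n" "p \<in> entry_index g n"
  shows "tuple_entry (tuple_smult c A) p = c * tuple_entry A p"
  using assms by (auto simp: tuple_entry_def entry_index_def tuple_smult_def nc_tuples_def)

lemma openin_tuple_ball: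
  assumes "X \<in> nc_tuples g n"
  shows "openin (nc_top g n) {Y \<in> nc_tuples g n. tuple_dist g n Y X < r}"
proof -
  interpret Metric_space "nc_tuples g n" "tuple_dist g n" by (rule Metric_space_tuples)
  have "{Y \<in> nc_tuples g n. tuple_dist g n Y X < r} = mball X r"
    using assms by (auto simp: commute)
  then show ?thesis by (simp add: nc_top_eq_mtopology)
qed

lemma (in open_nc_free_map) holomorphic_if_continuous:
  assumes g: "g \<ge> 1" and n: "n \<ge> 1"
    and cont: "\<And>n. n \<ge> 1 \<Longrightarrow> continuous_map (subtopology (nc_top g n) (U n)) (nc_top g' n) (f n)"
  shows "holomorphic_tuples g g' n (f n) (U n)"
  unfolding holomorphic_tuples_def
proof (intro ballI)
  fix X assume X: "X \<in> U n"
  have nn: "n + n \<ge> 1" and nnn: "n + n + n \<ge> 1" using n by auto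
  let ?L = "derivative n X"
  let ?XX = "tuple_tri X (replicate g (0\<^sub>m n n)) X"
  let ?XXX = "tuple_tri ?XX (replicate g (0\<^sub>m (n + n) n)) X"
  have XX: "?XX \<in> U (n + n)" by (rule dsum_mem[OF n n X X])
  have XXX: "?XXX \<in> U (n + n + n)" by (rule dsum_mem[OF nn n XX X])
  note cX = domain_closed[OF n X] and cXX = domain_closed[OF nn XX] and cXXX = domain_closed[OF nnn XXX]
  \<comment> \<open>Two neighbourhoods are required. At size \<open>2n\<close>, \<open>d1\<close>
    keeps \<open>P\<close> in \<open>U\<close>, as a diagonal block must be. At size
    \<open>3n\<close>, \<open>d3\<close> keeps the perturbed matrix in \<open>U\<close> and its
    image within distance 1 of the image of the direct sum.\<close>
  obtain d1 where d1: "d1 > 0" "\<And>W. W \<in> nc_tuples g (n + n) \<Longrightarrow> tuple_dist g (n + n) W ?XX < d1 \<Longrightarrow> W \<in> U (n + n)"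
    using openin_nc_topD[OF open_domain[OF nn] XX] by blast
  let ?S = "{W \<in> topspace (subtopology (nc_top g (n + n + n)) (U (n + n + n))).
      f (n + n + n) W \<in> {Z \<in> nc_tuples g' (n + n + n). tuple_dist g' (n + n + n) Z (f (n + n + n) ?XXX) < 1}}"
  have "openin (subtopology (nc_top g (n + n + n)) (U (n + n + n))) ?S"
    by (rule openin_continuous_map_preimage[OF cont[OF nnn] openin_tuple_ball[OF image_closed[OF nnn XXX]]])
  then have "openin (nc_top g (n + n + n)) ?S"
    by (rule openin_trans_full[OF _ open_domain[OF nnn]])
  moreover have "?XXX \<in> ?S"
    using XXX cXXX image_closed[OF nnn XXX] by (simp add: tuple_dist_def L2_set_def)
  ultimately obtain d3 where d3: "d3 > 0"
    "\<And>W. W \<in> nc_tuples g (n + n + n) \<Longrightarrow> tuple_dist g (n + n + n) W ?XXX < d3 \<Longrightarrow> W \<in> ?S"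
    by (rule openin_nc_topD) blast
  \<comment> \<open>\<open>N\<close> dominates both entry counts, so entrywise deviations of at most
    \<open>c\<close> amount to a distance of at most \<open>N * c\<close>, half of
    \<open>min d1 d3\<close>. The added 1 keeps \<open>N\<close> and \<open>M\<close>
    positive.\<close>
  define N where "N = real (card (entry_index g (n + n)) + card (entry_index g (n + n + n)) + 1)"
  define c where "c = min d1 d3 / (2 * N)"
  define M where "M = real (card (entry_index g' n) + 1)"
  have N: "N > 0" and M: "M > 0" by (auto simp: N_def M_def)
  have c: "c > 0" using d1(1) d3(1) N by (simp add: c_def)
  have "N * c < min d1 d3" using d1(1) d3(1) N by (simp add: c_def min_def)
  moreover have "card (entry_index g (n + n)) * c \<le> N * c" "card (entry_index g (n + n + n)) * c \<le> N * c"
    using c by (auto simp: N_def intro!: mult_right_mono)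
  ultimately have c1: "card (entry_index g (n + n)) * c < d1" and c3: "card (entry_index g (n + n + n)) * c < d3"
    by auto
  have bound: "tuple_dist g' n (tuple_sub (f n Y) (f n X)) (?L (tuple_sub Y X)) \<le> M * ((tuple_dist g n Y X)\<^sup>2 / c\<^sup>2)"
    if Y: "Y \<in> U n" and h: "tuple_dist g n Y X < c" for Y
  \<comment> \<open>The scale \<open>c / h\<close> requires \<open>h > 0\<close>. For
    \<open>Y = X\<close> the claim is that the derivative sends the zero direction to 0, which is
    homogeneity with factor 0.\<close>
  proof (cases "tuple_dist g n Y X = 0")
    case True
    note cY = domain_closed[OF n Y]
    have YX: "Y = X" using True Metric_space.zero[OF Metric_space_tuples cY cX] by simp
    let ?H = "tuple_sub X X"
    have cH: "?H \<in> nc_tuples g n" by (rule tuple_sub_closed[OF cX cX])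
    have "?H = tuple_smult 0 ?H"
    proof (rule nc_tuples_eqI[OF cH])
      show "tuple_smult 0 ?H \<in> nc_tuples g n"
        using cH tuple_smult_rect[of ?H g n n 0] by (simp add: nc_tuples_rect)
    qed (simp add: tuple_entry_sub[OF cX cX] tuple_entry_smult[OF cH])
    then have "?L ?H = tuple_smult 0 (?L ?H)" using derivative_smult[OF n X cH, of 0] by simp
    then have "tuple_entry (?L ?H) p = 0" if "p \<in> entry_index g' n" for p
      using tuple_entry_smult[OF derivative_closed[OF n X cH] that, of 0] by simp
    then have "tuple_dist g' n (tuple_sub (f n X) (f n X)) (?L ?H) = 0"
      using image_closed[OF n X] by (simp add: tuple_dist_def L2_set_eq_0_iff tuple_entry_sub)
    then show ?thesis using M YX by simp
  next
    case False
    note cY = domain_closed[OF n Y]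
    define h where "h = tuple_dist g n Y X"
    have h0: "h > 0" using False by (simp add: h_def tuple_dist_def L2_set_nonneg less_le)
    \<comment> \<open>The largest scale for which the bound \<open>h\<close> on the entries of
      \<open>H\<close> still gives entries of \<open>b H\<close> of modulus at most
      \<open>c\<close>.\<close>
    define b where "b = complex_of_real (c / h)"
    define H where "H = tuple_sub Y X"
    define P where "P = tuple_tri X (tuple_smult b H) X"
    define C where "C = map (\<lambda>k. 0\<^sub>m n n @\<^sub>r (- b) \<cdot>\<^sub>m H ! k) [0..<g]"
    have cH: "H \<in> nc_tuples g n" unfolding H_def by (rule tuple_sub_closed[OF cY cX])
    have YX: "cmod (Y ! k $$ (i, j) - X ! k $$ (i, j)) \<le> h" if "k < g" "i < n" "j < n" for k i j
      using entry_le_tuple_dist[of "(k, i, j)" g n Y X] that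
      by (simp add: entry_index_def tuple_entry_def h_def)
    have Hb: "cmod (b * H ! k $$ (i, j)) \<le> c" if "k < g" "i < n" "j < n" for k i j
    proof -
      have "H ! k $$ (i, j) = Y ! k $$ (i, j) - X ! k $$ (i, j)"
        using tuple_entry_sub[OF cY cX, of "(k, i, j)"] that
        by (simp add: entry_index_def tuple_entry_def H_def)
      then have "cmod (b * H ! k $$ (i, j)) \<le> c / h * h"
        using YX[OF that] c h0 unfolding b_def norm_mult
        by (intro mult_mono) (auto simp: norm_divide)
      then show ?thesis using h0 by simp
    qed
    have nP: "P \<in> nc_tuples g (n + n)" unfolding P_def by (rule tuple_tri_closed[OF cX cX])
    have bH: "tuple_smult b H ! k $$ (i, j) = b * H ! k $$ (i, j)" if "k < g" "i < n" "j < n" for k i j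
      using that tuple_entry_smult[OF cH, of "(k, i, j)" b] by (simp add: tuple_entry_def entry_index_def)
    have P_entry: "cmod (tuple_entry P p - tuple_entry ?XX p) \<le> c" if "p \<in> entry_index g (n + n)" for p
    proof -
      obtain k i j where p: "p = (k, i, j)" and kij: "k < g" "i < n + n" "j < n + n"
        using \<open>p \<in> _\<close> by (auto simp: entry_index_def)
      show ?thesis
        unfolding p P_def tuple_entry_tri[OF cX cX kij] using kij c Hb bH by auto
    qed
    have "tuple_dist g (n + n) P ?XX < d1"
      using tuple_dist_le[of g "n + n" P ?XX c] P_entry c1 by force
    then have PU: "P \<in> U (n + n)" using d1(2)[OF nP] by blast
    let ?Z = "tuple_tri P C Y"
    have nZ: "?Z \<in> nc_tuples g (n + n + n)" by (rule tuple_tri_closed[OF nP cY])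
    \<comment> \<open>The deviations from the direct sum of three copies of \<open>X\<close> are
      \<open>b H\<close> inside \<open>P\<close>, \<open>- b H\<close> inside \<open>C\<close>, and
      \<open>Y - X\<close> in the last diagonal block, whose entries are bounded by
      \<open>h < c\<close>.\<close>
    have "cmod (tuple_entry ?Z p - tuple_entry ?XXX p) \<le> c" if "p \<in> entry_index g (n + n + n)" for p
    proof -
      obtain k i j where p: "p = (k, i, j)" and kij: "k < g" "i < n + n + n" "j < n + n + n"
        using \<open>p \<in> _\<close> by (auto simp: entry_index_def)
      have "cmod (P ! k $$ (i, j) - ?XX ! k $$ (i, j)) \<le> c" if "i < n + n" "j < n + n"
        using P_entry[of "(k, i, j)"] that kij by (simp add: entry_index_def tuple_entry_def)
      moreover have "cmod (C ! k $$ (i, j - (n + n))) \<le> c" if "i < n + n" "\<not> j < n + n"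
        using Hb[OF kij(1), of "i - n" "j - (n + n)"] that kij c nc_tuples_nth[OF cH kij(1)]
        by (auto simp: C_def append_rows_def norm_mult)
      moreover have "cmod (Y ! k $$ (i - (n + n), j - (n + n)) - X ! k $$ (i - (n + n), j - (n + n))) \<le> c"
        if "\<not> i < n + n" "\<not> j < n + n"
        using YX[OF kij(1), of "i - (n + n)" "j - (n + n)"] that kij h by (force simp: h_def)
      ultimately show ?thesis
        unfolding p tuple_entry_tri[OF nP cY kij] tuple_entry_tri[OF cXX cX kij]
        using kij c by auto
    qed
    then have "tuple_dist g (n + n + n) ?Z ?XXX < d3"
      using tuple_dist_le[of g "n + n + n" ?Z ?XXX c] c3 by force
    then have ZS: "?Z \<in> ?S" by (rule d3(2)[OF nZ])
    then have ZU: "?Z \<in> U (n + n + n)" by simp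
    have fZ: "tuple_dist g' (n + n + n) (f (n + n + n) ?Z) (f (n + n + n) ?XXX) < 1" using ZS by simp
    note cf = image_closed[OF n X] image_closed[OF n Y]
    have "cmod (tuple_entry (tuple_sub (f n Y) (f n X)) p - tuple_entry (?L H) p) \<le> h\<^sup>2 / c\<^sup>2"
      if "p \<in> entry_index g' n" for p
    proof -
      obtain k i j where p: "p = (k, i, j)" and kij: "k < g'" "i < n" "j < n"
        using \<open>p \<in> _\<close> by (auto simp: entry_index_def)
      let ?E = "f n X ! k $$ (i, j) + ?L H ! k $$ (i, j) - f n Y ! k $$ (i, j)"
      \<comment> \<open>At the direct sum the far corner vanishes, so being within distance 1 of
        that value bounds the corner at \<open>?Z\<close> itself.\<close>
      have "f (n + n + n) ?XXX ! k $$ (i, n + n + j) = 0"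
      proof -
        have "corner (n + n) n (f (n + n + n) ?XXX) ! k $$ (i, j) = 0"
          using corner_dsum[OF nn n XX X kij(1)] kij by simp
        then show ?thesis
          using image_closed[OF nnn XXX] kij by (simp add: corner_nth nc_tuples_def)
      qed
      moreover have "(k, i, n + n + j) \<in> entry_index g' (n + n + n)" using kij by (simp add: entry_index_def)
      ultimately have "cmod (f (n + n + n) ?Z ! k $$ (i, n + n + j)) < 1"
        using fZ entry_le_tuple_dist[of "(k, i, n + n + j)" g' "n + n + n" "f (n + n + n) ?Z" "f (n + n + n) ?XXX"]
        by (simp add: tuple_entry_def)
      then have "cmod (b\<^sup>2 * ?E) < 1"
        using linearisation_error_entry[OF n X Y H_def P_def C_def PU ZU kij] by simp
      then have "(c / h)\<^sup>2 * cmod ?E < 1"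
        by (simp add: norm_mult norm_divide norm_power b_def power_divide)
      then have "cmod ?E \<le> h\<^sup>2 / c\<^sup>2"
        using c h0 by (simp add: field_simps)
      moreover have "tuple_entry (tuple_sub (f n Y) (f n X)) p - tuple_entry (?L H) p = - ?E"
        unfolding tuple_entry_sub[OF cf(2,1) \<open>p \<in> _\<close>] by (simp add: p tuple_entry_def)
      ultimately show ?thesis by (simp only: norm_minus_cancel)
    qed
    then have "tuple_dist g' n (tuple_sub (f n Y) (f n X)) (?L H) \<le> card (entry_index g' n) * (h\<^sup>2 / c\<^sup>2)"
      by (rule tuple_dist_le)
    also have "\<dots> \<le> M * (h\<^sup>2 / c\<^sup>2)" by (intro mult_right_mono) (auto simp: M_def)
    finally show ?thesis by (simp add: H_def h_def)
  qed
  show "\<exists>L. tuple_clinear g g' n L \<and>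
      (\<forall>e>0. \<exists>d>0. \<forall>Y\<in>U n. tuple_norm (tuple_sub Y X) < d \<longrightarrow>
        tuple_norm (tuple_sub (tuple_sub (f n Y) (f n X)) (L (tuple_sub Y X))) \<le> e * tuple_norm (tuple_sub Y X))"
  proof (intro exI[of _ ?L] conjI allI impI)
    show "tuple_clinear g g' n ?L" by (rule tuple_clinear_derivative[OF n X])
    fix e :: real assume e: "e > 0"
    show "\<exists>d>0. \<forall>Y\<in>U n. tuple_norm (tuple_sub Y X) < d \<longrightarrow>
        tuple_norm (tuple_sub (tuple_sub (f n Y) (f n X)) (?L (tuple_sub Y X))) \<le> e * tuple_norm (tuple_sub Y X)"
    \<comment> \<open>For \<open>h\<close> below \<open>c\<close> the error is at most
      \<open>M h\<^sup>2 / c\<^sup>2\<close>, and this is at most \<open>e h\<close> as soon as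
      \<open>h\<close> is at most \<open>e c\<^sup>2 / M\<close>.\<close>
    proof (intro exI[of _ "min c (e * c\<^sup>2 / M)"] conjI ballI impI)
      show "min c (e * c\<^sup>2 / M) > 0" using c e M by simp
      fix Y assume Y: "Y \<in> U n"
      note cY = domain_closed[OF n Y]
      let ?h = "tuple_dist g n Y X"
      have cs: "tuple_sub (f n Y) (f n X) \<in> nc_tuples g' n"
        by (rule tuple_sub_closed[OF image_closed[OF n Y] image_closed[OF n X]])
      have cH: "?L (tuple_sub Y X) \<in> nc_tuples g' n"
        by (rule derivative_closed[OF n X tuple_sub_closed[OF cY cX]])
      assume "tuple_norm (tuple_sub Y X) < min c (e * c\<^sup>2 / M)"
      then have h: "?h < c" "?h < e * c\<^sup>2 / M" by (auto simp: tuple_norm_sub[OF cY cX])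
      have "M * (?h\<^sup>2 / c\<^sup>2) = (M * ?h / c\<^sup>2) * ?h" by (simp add: power2_eq_square)
      also have "\<dots> \<le> e * ?h"
      proof (rule mult_right_mono)
        show "M * ?h / c\<^sup>2 \<le> e" using h(2) M c by (simp add: field_simps)
      qed (simp add: tuple_dist_def L2_set_nonneg)
      finally show "tuple_norm (tuple_sub (tuple_sub (f n Y) (f n X)) (?L (tuple_sub Y X))) \<le> e * tuple_norm (tuple_sub Y X)"
        unfolding tuple_norm_sub[OF cY cX] tuple_norm_sub[OF cs cH] using bound[OF Y h(1)] by linarith
    qed
  qed
qed

section \<open>Surjectivity and continuity of the inverse\<close>

lemma metrizable_nc_top: "metrizable_space (nc_top g n)"
  unfolding nc_top_eq_mtopology by (rule Metric_space.metrizable_space_mtopology[OF Metric_space_tuples])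

text \<open>The image is open by invariance of domain. It is closed in \<open>V\<close> because
  \<open>V\<close>, being metrizable, is a k-space with closed compact sets, where compact preimages
  already make a continuous map proper and hence closed. A nonempty clopen subset of the connected
  \<open>V\<close> is all of \<open>V\<close>.\<close>

lemma proper_injective_imp_homeomorphism:
  assumes U: "openin (nc_top g n) U" "U \<noteq> {}" and V: "connectedin (nc_top g n) V"
    and fV: "f ` U \<subseteq> V" and cont: "continuous_map (subtopology (nc_top g n) U) (nc_top g n) f"
    and inj: "inj_on f U"
    and proper: "\<And>K. compactin (subtopology (nc_top g n) V) K \<Longrightarrow>
      compactin (subtopology (nc_top g n) U) {X \<in> U. f X \<in> K}"
  shows "bij_betw f U V" "continuous_map (subtopology (nc_top g n) V) (nc_top g n) (the_inv_into U f)"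
proof -
  let ?T = "nc_top g n"
  have VT: "V \<subseteq> nc_tuples g n" and UT: "U \<subseteq> nc_tuples g n"
    using connectedin_subset_topspace[OF V] openin_subset[OF U(1)] by auto
  have tU: "topspace (subtopology ?T U) = U" and tV: "topspace (subtopology ?T V) = V"
    using UT VT by auto
  have open_image: "openin ?T (f ` W)" if "openin ?T W" "W \<subseteq> U" for W
    using that inj cont
    by (intro invariance_of_domain_nc_top) (auto intro: continuous_map_from_subtopology_mono inj_on_subset)
  have m: "metrizable_space (subtopology ?T V)" by (rule metrizable_space_subtopology[OF metrizable_nc_top])
  have "proper_map (subtopology ?T U) (subtopology ?T V) f"
  proof (rule compact_imp_proper_map)
    show "k_space (subtopology ?T V)" by (rule metrizable_imp_k_space[OF m])
    show "kc_space (subtopology ?T V)"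
      by (rule Hausdorff_imp_kc_space[OF metrizable_imp_Hausdorff_space[OF m]])
    show "f \<in> topspace (subtopology ?T U) \<rightarrow> topspace (subtopology ?T V)"
      unfolding tU tV using fV by auto
    show "continuous_map (subtopology ?T U) (subtopology ?T V) f \<or> kc_space (subtopology ?T U)"
      using cont fV tU by (auto simp: continuous_map_in_subtopology)
  qed (use proper tU in simp)
  then have "closed_map (subtopology ?T U) (subtopology ?T V) f" by (rule proper_imp_closed_map)
  then have "closedin (subtopology ?T V) (f ` U)"
    using tU closedin_topspace[of "subtopology ?T U"] by (auto simp: closed_map_def)
  moreover have "openin (subtopology ?T V) (f ` U)"
    using open_image[OF U(1)] fV unfolding openin_subtopology by blast
  moreover have "connectedin (subtopology ?T V) V" using V by (simp add: connectedin_subtopology)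
  ultimately have "V \<subseteq> f ` U \<or> disjnt V (f ` U)" by (rule connectedin_clopen_cases[rotated])
  then have im: "f ` U = V" using fV U(2) by (auto simp: disjnt_def)
  then show b: "bij_betw f U V" using inj by (simp add: bij_betw_def)
  let ?i = "the_inv_into U f"
  show "continuous_map (subtopology ?T V) ?T ?i"
    unfolding continuous_map_def
  proof (intro conjI allI impI)
    have iU: "?i Z \<in> U" if "Z \<in> V" for Z
      using the_inv_into_into[OF inj _ order_refl] im that by blast
    then show "?i \<in> topspace (subtopology ?T V) \<rightarrow> topspace ?T" using UT by auto
    fix W assume W: "openin ?T W"
    \<comment> \<open>Preimages under the inverse are direct images under \<open>f\<close>, so
      openness of \<open>f\<close> on subsets of \<open>U\<close> is continuity of the
      inverse.\<close>
    have "{Z \<in> topspace (subtopology ?T V). ?i Z \<in> W} = f ` (U \<inter> W)"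
      unfolding tV using iU f_the_inv_into_f[OF inj] the_inv_into_f_f[OF inj] im by (auto simp: image_iff)
    moreover have "openin ?T (f ` (U \<inter> W))" using open_image[of "U \<inter> W"] U(1) W by auto
    ultimately show "openin (subtopology ?T V) {Z \<in> topspace (subtopology ?T V). ?i Z \<in> W}"
      using im by (auto simp: openin_subtopology)
  qed
qed

theorem theorem3p1:
  fixes g g' :: nat
    and U V :: "nat \<Rightarrow> complex mat list set"
    and f :: "nat \<Rightarrow> complex mat list \<Rightarrow> complex mat list"
  assumes "g \<ge> 1" and "g' \<ge> 1"
    and "nc_domain g U" and "contains_zero g U"
    and "nc_domain g' V" and "contains_zero g' V"
    and "free_map g g' U f" and "maps_into U V f"
  shows
    "(proper_nc g g' U V f \<longrightarrow>
        one_to_one U f \<and> free_map g' g (nc_image f U) (nc_inverse f U)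
        \<and> maps_into (nc_image f U) U (nc_inverse f U))
     \<and>
     ((\<forall>n\<ge>1. \<forall>Z\<in>nc_tuples g' n.
         compactin (subtopology (nc_top g n) (U n))
           ((subtopology (nc_top g n) (U n)) closure_of {X \<in> U n. f n X = Z})) \<longrightarrow>
        one_to_one U f \<and> free_map g' g (nc_image f U) (nc_inverse f U)
        \<and> maps_into (nc_image f U) U (nc_inverse f U))
     \<and>
     (g = g' \<and> proper_nc g g' U V f \<and> continuous_nc g g' U f \<longrightarrow>
        (\<forall>n\<ge>1. bij_betw (f n) (U n) (V n)) \<and>
        analytic_free_map g g' U f \<and> maps_into U V f \<and> proper_nc g g' U V f \<and>
        analytic_free_map g' g V (nc_inverse f U) \<and> maps_into V U (nc_inverse f U) \<and>
        proper_nc g' g V U (nc_inverse f U))"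
proof -
  interpret open_nc_free_map g g' U f
    using assms by unfold_locales (auto simp: nc_domain_def)
  have fV: "f n X \<in> V n" if "n \<ge> 1" "X \<in> U n" for n X
    using assms(8) that by (auto simp: maps_into_def)
  have part1: "one_to_one U f \<and> free_map g' g (nc_image f U) (nc_inverse f U)
      \<and> maps_into (nc_image f U) U (nc_inverse f U)" if proper: "proper_nc g g' U V f"
  proof -
    have "\<exists>K. compactin (nc_top g n) K \<and> {W \<in> U n. f n W = f n X} \<subseteq> K \<and> K \<subseteq> U n"
      if n: "n \<ge> 1" and X: "X \<in> U n" for n X
    proof -
      \<comment> \<open>A fibre is the preimage of a point, and a point is compact; the fibre itself
        thus serves as \<open>K\<close>.\<close>
      have "compactin (subtopology (nc_top g' n) (V n)) {f n X}"
        using image_closed[OF n X] fV[OF n X] by simp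
      then have "compactin (subtopology (nc_top g n) (U n)) {W \<in> U n. f n W \<in> {f n X}}"
        using proper n unfolding proper_nc_def by blast
      then show ?thesis by (auto simp: compactin_subtopology)
    qed
    from inverse_free_map[OF this] show ?thesis by blast
  qed
  moreover have "one_to_one U f \<and> free_map g' g (nc_image f U) (nc_inverse f U)
      \<and> maps_into (nc_image f U) U (nc_inverse f U)"
    if fibers: "\<forall>n\<ge>1. \<forall>Z\<in>nc_tuples g' n. compactin (subtopology (nc_top g n) (U n))
           ((subtopology (nc_top g n) (U n)) closure_of {X \<in> U n. f n X = Z})"
  proof -
    have "\<exists>K. compactin (nc_top g n) K \<and> {W \<in> U n. f n W = f n X} \<subseteq> K \<and> K \<subseteq> U n"
      if n: "n \<ge> 1" and X: "X \<in> U n" for n X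
    proof -
      let ?F = "{W \<in> U n. f n W = f n X}"
      \<comment> \<open>The closure is relative to \<open>U n\<close>, so its compactness there also
        gives \<open>?K \<subseteq> U n\<close>.\<close>
      let ?K = "(subtopology (nc_top g n) (U n)) closure_of ?F"
      have "compactin (subtopology (nc_top g n) (U n)) ?K"
        using fibers n image_closed[OF n X] by blast
      moreover have "?F \<subseteq> ?K"
        by (rule closure_of_subset) (use domain_closed[OF n] in auto)
      ultimately show ?thesis by (auto simp: compactin_subtopology)
    qed
    from inverse_free_map[OF this] show ?thesis by blast
  qed
  moreover have "(\<forall>n\<ge>1. bij_betw (f n) (U n) (V n)) \<and>
        analytic_free_map g g' U f \<and> maps_into U V f \<and> proper_nc g g' U V f \<and>
        analytic_free_map g' g V (nc_inverse f U) \<and> maps_into V U (nc_inverse f U) \<and>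
        proper_nc g' g V U (nc_inverse f U)"
    if gg: "g = g'" and proper: "proper_nc g g' U V f" and cont: "continuous_nc g g' U f"
  proof -
    have p1: "one_to_one U f" "free_map g' g (nc_image f U) (nc_inverse f U)"
      using part1[OF proper] by auto
    have homeo: "bij_betw (f n) (U n) (V n)"
      "continuous_map (subtopology (nc_top g n) (V n)) (nc_top g n) (nc_inverse f U n)"
      if n: "n \<ge> 1" for n
    proof -
      have U0: "U n \<noteq> {}" using assms(4) n by (auto simp: contains_zero_def)
      have V: "connectedin (nc_top g n) (V n)" using assms(5) n gg by (simp add: nc_domain_def)
      have c: "continuous_map (subtopology (nc_top g n) (U n)) (nc_top g n) (f n)"
        using cont n gg by (simp add: continuous_nc_def)
      have i: "inj_on (f n) (U n)" using p1(1) n by (simp add: one_to_one_def)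
      have pr: "compactin (subtopology (nc_top g n) (U n)) {X \<in> U n. f n X \<in> K}"
        if "compactin (subtopology (nc_top g n) (V n)) K" for K
        using proper n gg that by (simp add: proper_nc_def)
      have fVn: "f n ` U n \<subseteq> V n" using fV[OF n] by blast
      note * = proper_injective_imp_homeomorphism[OF open_domain[OF n] U0 V fVn c i pr]
      show "bij_betw (f n) (U n) (V n)" by (rule *(1))
      show "continuous_map (subtopology (nc_top g n) (V n)) (nc_top g n) (nc_inverse f U n)"
        unfolding nc_inverse_def by (rule *(2))
    qed
    have im: "nc_image f U n = V n" if "n \<ge> 1" for n
      using homeo(1)[OF that] by (simp add: nc_image_def bij_betw_def)
    have free': "free_map g' g V (nc_inverse f U)"
      using p1(2) unfolding free_map_def by (simp add: im)
    have inv: "maps_into V U (nc_inverse f U)"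
      using homeo(1) by (auto simp: maps_into_def nc_inverse_def bij_betw_def the_inv_into_into)
    \<comment> \<open>With the roles of \<open>U\<close> and \<open>V\<close> exchanged, the
      differentiability argument applies verbatim to the inverse, already known to be free and
      continuous.\<close>
    interpret inverse: open_nc_free_map g' g V "nc_inverse f U"
      using assms(5) free' by unfold_locales (auto simp: nc_domain_def)
    have "holomorphic_tuples g g' n (f n) (U n)" if "n \<ge> 1" for n
      using holomorphic_if_continuous[OF assms(1) that] cont by (simp add: continuous_nc_def)
    then have "analytic_free_map g g' U f"
      using assms(3,7) by (simp add: analytic_free_map_def)
    moreover have "holomorphic_tuples g' g n (nc_inverse f U n) (V n)" if "n \<ge> 1" for n
      using inverse.holomorphic_if_continuous[OF assms(2) that] homeo(2) gg by simp
    then have "analytic_free_map g' g V (nc_inverse f U)"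
      using assms(5) free' by (simp add: analytic_free_map_def)
    moreover have "proper_nc g' g V U (nc_inverse f U)"
      unfolding proper_nc_def
    proof (intro allI impI)
      fix n K assume n: "(n :: nat) \<ge> 1" and K: "compactin (subtopology (nc_top g n) (U n)) K"
      have KU: "K \<subseteq> U n" using K by (simp add: compactin_subtopology)
      \<comment> \<open>Properness of the inverse reduces to continuity of \<open>f\<close>:
        preimages under the inverse are images under \<open>f\<close>, and these preserve
        compactness.\<close>
      have "{Z \<in> V n. nc_inverse f U n Z \<in> K} = f n ` K"
      proof -
        have inj: "inj_on (f n) (U n)" and fU: "f n ` U n = V n"
          using homeo(1)[OF n] by (auto simp: bij_betw_def)
        show ?thesis
          unfolding nc_inverse_def fU[symmetric] using KU the_inv_into_f_f[OF inj] by force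
      qed
      moreover have "continuous_map (subtopology (nc_top g n) (U n)) (subtopology (nc_top g' n) (V n)) (f n)"
        using cont n fV[OF n] by (auto simp: continuous_nc_def continuous_map_in_subtopology)
      from image_compactin[OF K this] have "compactin (subtopology (nc_top g' n) (V n)) (f n ` K)" .
      ultimately show "compactin (subtopology (nc_top g' n) (V n)) {Z \<in> V n. nc_inverse f U n Z \<in> K}"
        by simp
    qed
    ultimately show ?thesis using homeo(1) assms(8) proper inv by blast
  qed
  ultimately show ?thesis by blast
qed

end
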